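(* The RCE condition for analytic S-multimodal interval maps is not topologically invariant: there exist two real-analytic S-multimodal maps $f,g:[0,1]\to[0,1]$ and a homeomorphism $\phi:[0,1]\to[0,1]$ with $\phi\circ f=g\circ\phi$ such that $f$ satisfies RCE and $g$ does not satisfy RCE.
   Context: Let $I=[0,1]$. A continuous map $f:I\to I$ is $l$-modal ($l\ge 1$) if $f(\partial I)\subseteq\partial I$ and there are $l$ turning points $0<c_1<\dots<c_l<1$ (points where $f$ has a local extremum) such that $f$ is strictly monotone on each of the intervals $[0,c_1),(c_1,c_2),\dots,(c_l,1]$. A $C^1$ $l$-modal map is assumed moreover to have $f'(x)\neq 0$ for $x\notin\{c_1,\dots,c_l\}$. The critical set is $\mathrm{Crit}_f=\{c_1,\dots,c_l\}$. A map is multimodal if it is $l$-modal for some $l$. A $C^3$ multimodal map has negative Schwarzian derivative if $$Sf(x)=\frac{f'''(x)}{f'(x)}-\frac32\left(\frac{f''(x)}{f'(x)}\right)^2<0\quad\text{for all }x\in I\setminus\mathrm{Crit}_f.$$ An S-multimodal map is a multimodal map with negative Schwarzian derivative. RCE (interval version): every critical point $c\in\mathrm{Crit}_f$ that is recurrent (i.e. $c\in\omega(c)$, where $\omega(c)$ is the set of accumulation points of the orbit $(f^n(c))_{n>0}$) is Collet-Eckmann, that is, there exist $C>0$ and $\lambda>1$ with $|(f^n)'(f(c))|>C\lambda^n$ for all $n\geq 0$. *)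

theory Defs
  imports "HOL-Analysis.Analysis"
begin

text \<open>
  A map of the unit interval is represented by a function of type \<open>real \<Rightarrow> real\<close> of which
  only the restriction to \<open>{0..1}\<close> matters: limits, derivatives and local extrema are all
  taken within \<open>{0..1}\<close>, so derivatives at the endpoints are one-sided.
\<close>

abbreviation I01 :: "real set" where
  "I01 \<equiv> {0..1}"

fun nderiv :: "nat \<Rightarrow> (real \<Rightarrow> real) \<Rightarrow> real \<Rightarrow> real" where
  "nderiv 0 f = f"
| "nderiv (Suc k) f = (\<lambda>x. vector_derivative (nderiv k f) (at x within I01))"

definition C_k :: "nat \<Rightarrow> (real \<Rightarrow> real) \<Rightarrow> bool" where
  "C_k k f \<longleftrightarrow> (\<forall>j<k. nderiv j f differentiable_on I01) \<and> continuous_on I01 (nderiv k f)"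

text \<open>
  Every point of the interval, endpoints included, has a power series expansion; this is
  the same as being the restriction of a real-analytic function on an open neighbourhood.
\<close>

definition real_analytic :: "(real \<Rightarrow> real) \<Rightarrow> bool" where
  "real_analytic f \<longleftrightarrow>
     (\<forall>x\<in>I01. \<exists>r>0. \<exists>a :: nat \<Rightarrow> real. \<forall>y\<in>I01. \<bar>y - x\<bar> < r \<longrightarrow>
        (\<lambda>n. a n * (y - x) ^ n) sums f y)"

definition turning_point :: "(real \<Rightarrow> real) \<Rightarrow> real \<Rightarrow> bool" where
  "turning_point f c \<longleftrightarrow> 0 < c \<and> c < 1 \<and>
     ((\<forall>\<^sub>F y in at c within I01. f y \<le> f c) \<or> (\<forall>\<^sub>F y in at c within I01. f c \<le> f y))"

definition Crit :: "(real \<Rightarrow> real) \<Rightarrow> real set" where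
  "Crit f = {c. turning_point f c}"

definition strictly_monotone_on :: "real set \<Rightarrow> (real \<Rightarrow> real) \<Rightarrow> bool" where
  "strictly_monotone_on A f \<longleftrightarrow>
     strict_mono_on A f \<or> monotone_on A (<) (\<lambda>x y. y < x) f"

definition modal_at :: "(real \<Rightarrow> real) \<Rightarrow> real list \<Rightarrow> bool" where
  "modal_at f cs \<longleftrightarrow>
     cs \<noteq> [] \<and> sorted_wrt (<) cs \<and> (\<forall>c\<in>set cs. turning_point f c) \<and>
     strictly_monotone_on {0..<hd cs} f \<and>
     (\<forall>i. Suc i < length cs \<longrightarrow> strictly_monotone_on {cs ! i<..<cs ! Suc i} f) \<and>
     strictly_monotone_on {last cs<..1} f"

definition l_modal :: "nat \<Rightarrow> (real \<Rightarrow> real) \<Rightarrow> bool" where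
  "l_modal l f \<longleftrightarrow> 1 \<le> l \<and>
     continuous_on I01 f \<and> f ` I01 \<subseteq> I01 \<and> f ` {0, 1} \<subseteq> {0, 1} \<and>
     (\<exists>cs. length cs = l \<and> modal_at f cs)"

definition multimodal :: "(real \<Rightarrow> real) \<Rightarrow> bool" where
  "multimodal f \<longleftrightarrow> (\<exists>l. l_modal l f)"

text \<open>
  The turning points listed in the definition of a modal map are all the turning points of
  the map, so that \<open>Crit f\<close> is indeed the set of the listed points.
\<close>

lemma not_turning_point:
  assumes "strictly_monotone_on A f" "open U" "x \<in> U" "U \<subseteq> A" "U \<subseteq> I01"
  shows "\<not> turning_point f x"
proof -
  have no: "\<not> (\<forall>\<^sub>F y in at x within I01. g y \<le> g x)"
    if "strictly_monotone_on A g" for g :: "real \<Rightarrow> real"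
  proof
    assume "\<forall>\<^sub>F y in at x within I01. g y \<le> g x"
    then obtain d where d: "d > 0" "\<And>y. \<lbrakk>y \<in> I01; y \<noteq> x; dist y x < d\<rbrakk> \<Longrightarrow> g y \<le> g x"
      unfolding eventually_at by auto
    obtain e where e: "e > 0" "ball x e \<subseteq> U"
      using assms(2,3) open_contains_ball by blast
    define h where "h = min d e / 2"
    have h: "h > 0" "h < d" "h < e" using d(1) e(1) by (auto simp: h_def min_def)
    have in_U: "x - h \<in> U" "x + h \<in> U"
      using e(2) h by (auto simp: dist_real_def subset_eq)
    then have "g (x - h) \<le> g x" "g (x + h) \<le> g x"
      using d(2)[of "x - h"] d(2)[of "x + h"] h assms(5) by (auto simp: dist_real_def)
    moreover have "x - h \<in> A" "x \<in> A" "x + h \<in> A" using in_U assms(3,4) by auto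
    ultimately show False
      using that h(1) unfolding strictly_monotone_on_def monotone_on_def
      by (metis add.commute diff_less_eq leD less_add_same_cancel2)
  qed
  have "strictly_monotone_on A (\<lambda>y. - f y)"
    using assms(1) unfolding strictly_monotone_on_def monotone_on_def by auto
  then show ?thesis
    using no[OF assms(1)] no[of "\<lambda>y. - f y"] unfolding turning_point_def by simp
qed

lemma Crit_eq:
  assumes "modal_at f cs"
  shows "Crit f = set cs"
proof -
  have cs: "cs \<noteq> []" "sorted_wrt (<) cs" and tp: "\<And>c. c \<in> set cs \<Longrightarrow> turning_point f c"
    and first: "strictly_monotone_on {0..<hd cs} f"
    and mid: "\<And>i. Suc i < length cs \<Longrightarrow> strictly_monotone_on {cs ! i<..<cs ! Suc i} f"
    and lst: "strictly_monotone_on {last cs<..1} f"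
    using assms unfolding modal_at_def by auto
  have range: "0 < c" "c < 1" if "c \<in> set cs" for c
    using tp[OF that] by (auto simp: turning_point_def)
  have "x \<in> set cs" if x: "turning_point f x" for x
  proof (rule ccontr)
    assume nx: "x \<notin> set cs"
    have x01: "0 < x" "x < 1" using x by (auto simp: turning_point_def)
    consider "x < hd cs" | "last cs < x" | "hd cs < x" "x < last cs"
      using nx cs(1) by (metis hd_in_set last_in_set linorder_neqE)
    then show False
    proof cases
      case 1
      have "{0<..<hd cs} \<subseteq> {0..<hd cs}" "{0<..<hd cs} \<subseteq> I01"
        using range[of "hd cs"] cs(1) by (auto simp: subset_eq)
      then show False
        using not_turning_point[OF first, of "{0<..<hd cs}" x] x x01 1 by simp
    next
      case 2
      have "{last cs<..<1} \<subseteq> {last cs<..1}" "{last cs<..<1} \<subseteq> I01"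
        using range[of "last cs"] cs(1) by (auto simp: subset_eq)
      then show False
        using not_turning_point[OF lst, of "{last cs<..<1}" x] x x01 2 by simp
    next
      case 3
      define k where "k = (LEAST k. k < length cs \<and> x < cs ! k)"
      have "length cs - 1 < length cs \<and> x < cs ! (length cs - 1)"
        using 3 cs(1) by (simp add: last_conv_nth)
      then have k: "k < length cs" "x < cs ! k"
        unfolding k_def by (metis (mono_tags, lifting) LeastI)+
      have "k \<noteq> 0" using k 3 cs(1) by (metis hd_conv_nth less_asym)
      then obtain i where i: "k = Suc i" by (cases k) auto
      have "\<not> x < cs ! i"
        using not_less_Least[of i "\<lambda>k. k < length cs \<and> x < cs ! k"] i k(1)
        unfolding k_def by auto
      moreover have "cs ! i \<noteq> x" using nx i k(1) by auto
      ultimately have "cs ! i < x" by simp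
      moreover have "{cs ! i<..<cs ! Suc i} \<subseteq> I01"
        using range[of "cs ! i"] range[of "cs ! Suc i"] i k(1) by (auto simp: subset_eq)
      ultimately show False
        using not_turning_point[OF mid[of i], of "{cs ! i<..<cs ! Suc i}" x] x i k by simp
    qed
  qed
  then show ?thesis using tp unfolding Crit_def by auto
qed

definition Schwarzian :: "(real \<Rightarrow> real) \<Rightarrow> real \<Rightarrow> real" where
  "Schwarzian f x =
     nderiv 3 f x / nderiv 1 f x - 3 / 2 * (nderiv 2 f x / nderiv 1 f x)\<^sup>2"

definition S_multimodal :: "(real \<Rightarrow> real) \<Rightarrow> bool" where
  "S_multimodal f \<longleftrightarrow> multimodal f \<and> C_k 3 f \<and>
     (\<forall>x\<in>I01 - Crit f. nderiv 1 f x \<noteq> 0) \<and>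
     (\<forall>x\<in>I01 - Crit f. Schwarzian f x < 0)"

text \<open>
  Accumulation points are those of the orbit as a sequence, that is, limits of subsequences.
  In particular a periodic point belongs to its own omega-limit set.
\<close>

definition omega_limit :: "(real \<Rightarrow> real) \<Rightarrow> real \<Rightarrow> real set" where
  "omega_limit f x =
     {y. \<exists>r :: nat \<Rightarrow> nat. strict_mono r \<and> ((\<lambda>n. (f ^^ Suc n) x) \<circ> r) \<longlonglongrightarrow> y}"

definition recurrent :: "(real \<Rightarrow> real) \<Rightarrow> real \<Rightarrow> bool" where
  "recurrent f c \<longleftrightarrow> c \<in> omega_limit f c"

definition Collet_Eckmann :: "(real \<Rightarrow> real) \<Rightarrow> real \<Rightarrow> bool" where
  "Collet_Eckmann f c \<longleftrightarrow>
     (\<exists>C>0. \<exists>\<Lambda>>1. \<forall>n. \<bar>nderiv 1 (f ^^ n) (f c)\<bar> > C * \<Lambda> ^ n)"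

definition RCE :: "(real \<Rightarrow> real) \<Rightarrow> bool" where
  "RCE f \<longleftrightarrow> (\<forall>c\<in>Crit f. recurrent f c \<longrightarrow> Collet_Eckmann f c)"

end

theory Submission
  imports Defs "HOL-Computational_Algebra.Polynomial" "HOL-Real_Asymp.Real_Asymp"
begin

text \<open>
  The two maps are \<open>F(x) = x ((x\<^sup>2 - a) / (1 - a))\<^sup>2\<close> and \<open>G(y) = y
  ((y - a) / (1 - a))^4\<close> for a suitable parameter \<open>a\<close>. Since
  \<open>G(x\<^sup>2) = F(x)\<^sup>2\<close>, they are conjugate by the homeomorphism
  \<open>\<phi>(x) = x\<^sup>2\<close>, which is a diffeomorphism except at the fixed point
  \<open>0\<close>. Both are polynomials with real critical points only, and therefore have
  negative Schwarzian derivative (\<open>Schwarzian_neg\<close>). Each map has two turning points: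
  a maximum \<open>c1\<close>, whose value depends on \<open>a\<close>, and a minimum
  \<open>c2\<close>, of order two for \<open>F\<close> and of order four for \<open>G\<close>,
  which is mapped to the fixed point \<open>0\<close>. (The turning points of \<open>G\<close> are
  the squares of those of \<open>F\<close>.)

  With \<open>x(n)\<close> the orbit of the critical value of \<open>F\<close>, the derivatives
  along the critical orbits are \<open>sqrt (x(n) / x(0)) \<Prod> |E(x(i))|\<close> for
  \<open>F\<close> and \<open>(x(n) / x(0))^(3/2) \<Prod> |E(x(i))|\<close> for \<open>G\<close>,
  with \<open>E(x) = (5 x\<^sup>2 - a) / (1 - a)\<close> (\<open>abs_prod_DF\<close>,
  \<open>abs_prod_DG\<close>). If the orbit spends almost all its time near \<open>0\<close>, the
  product is about \<open>e^n\<close>, where \<open>e = \<bar>E(0)\<bar>\<close> and the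
  multiplier of \<open>F\<close> at \<open>0\<close> is \<open>e\<^sup>2\<close>. If at time
  \<open>n\<close> the orbit is about to spend the next \<open>\<theta> n\<close> steps near
  \<open>0\<close>, then \<open>x(n)\<close> is about \<open>e^(- 2 \<theta> n)\<close>, and the
  derivatives are about \<open>e^((1 - \<theta>) n)\<close> and \<open>e^((1 - 3 \<theta>)
  n)\<close>. So for \<open>1/3 < \<theta> < 1\<close> the critical point of \<open>F\<close> can
  be Collet-Eckmann while that of \<open>G\<close> is not; the construction takes \<open>\<theta>
  = 1/2\<close>.

  What remains is a parameter for which the critical orbit has these properties and is recurrent.
  It is prescribed by a kneading sequence: blocks of geometrically growing length, each of which
  consists of a very short copy of the beginning of the sequence, responsible for recurrence, and
  a long run near \<open>0\<close>. The sequence exceeds all its proper tails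
  (\<open>tails_fall_below\<close>), so the intermediate value theorem and compactness give a
  parameter that realizes it (\<open>exists_param_itinerary\<close>). The copies are so sparse and
  short that even crude Lipschitz bounds for the close returns to \<open>c1\<close> leave the
  growth rates unchanged (\<open>loss_sublinear\<close>). Expansion also shows that agreement of
  itineraries over long times implies closeness, whence recurrence (\<open>returns_close\<close>).
\<close>

section \<open>Polynomial maps of the unit interval\<close>

lemma vector_derivative_I01:
  assumes "(f has_real_derivative D) (at x)" "x \<in> I01"
  shows "vector_derivative f (at x within I01) = D"
proof -
  have "(f has_vector_derivative D) (at x within cbox 0 1)"
    using assms(1) has_vector_derivative_at_within
    by (auto simp: has_real_derivative_iff_has_vector_derivative)
  then show ?thesis
    using vector_derivative_within_cbox[of 0 1 x f D] assms(2) by simp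
qed

text \<open>
  Only values on the interval enter one-sided derivatives, so for a polynomial they are the formal
  derivatives; this turns all smoothness conditions into statements about polynomials.
\<close>

lemma nderiv_poly:
  assumes "x \<in> I01"
  shows "nderiv k (poly p) x = poly ((pderiv ^^ k) p) x"
  using assms
proof (induction k arbitrary: x)
  case (Suc k)
  let ?q = "(pderiv ^^ k) p"
  have "(poly ?q has_vector_derivative poly (pderiv ?q) x) (at x within I01)"
    by (rule has_vector_derivative_at_within[OF
          poly_DERIV[THEN has_real_derivative_iff_has_vector_derivative[THEN iffD1]]])
  then have "(nderiv k (poly p) has_vector_derivative poly (pderiv ?q) x) (at x within I01)"
    by (rule has_vector_derivative_transform[rotated -1]) (use Suc in auto)
  then show ?case
    using Suc.prems vector_derivative_within_cbox[of 0 1 x "nderiv k (poly p)"] by simp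
qed simp

lemma C_k_poly: "C_k k (poly p)"
proof -
  have "nderiv j (poly p) differentiable_on I01" for j
    unfolding differentiable_on_def
  proof
    fix x :: real assume x: "x \<in> I01"
    define q where "q = (pderiv ^^ j) p"
    define D where "D = (*) (poly (pderiv q) x)"
    have "(poly q has_derivative D) (at x within I01)"
      unfolding D_def
      by (rule has_derivative_at_withinI) (use poly_DERIV[of q x] in \<open>simp add: has_field_derivative_def\<close>)
    then have "(nderiv j (poly p) has_derivative D) (at x within I01)"
      by (rule has_derivative_transform[rotated -1]) (use x in \<open>auto simp: nderiv_poly q_def\<close>)
    then show "nderiv j (poly p) differentiable at x within I01"
      unfolding differentiable_def by blast
  qed
  then show ?thesis
    unfolding C_k_def by (simp add: differentiable_imp_continuous_on)
qed

lemma real_analytic_poly: "real_analytic (poly p)"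
  unfolding real_analytic_def
proof
  fix x :: real assume "x \<in> I01"
  define q where "q = pcompose p [:x, 1:]"
  have "(\<lambda>n. coeff q n * (y - x) ^ n) sums poly p y" for y
  proof -
    have "(\<lambda>n. coeff q n * (y - x) ^ n) sums (\<Sum>n\<le>degree q. coeff q n * (y - x) ^ n)"
      by (rule sums_finite) (auto simp: coeff_eq_0)
    also have "(\<Sum>n\<le>degree q. coeff q n * (y - x) ^ n) = poly p y"
      by (simp add: q_def poly_pcompose flip: poly_altdef)
    finally show ?thesis .
  qed
  then show "\<exists>r>0. \<exists>a. \<forall>y\<in>I01. \<bar>y - x\<bar> < r \<longrightarrow> (\<lambda>n. a n * (y - x) ^ n) sums poly p y"
    by (intro exI[of _ 1]) auto
qed

definition root_poly :: "real list \<Rightarrow> real poly" where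
  "root_poly rs = prod_list (map (\<lambda>r. [:- r, 1:]) rs)"

text \<open>
  The first two derivatives of a product of linear factors, in terms of its logarithmic derivative
  \<open>w = \<Sum> 1 / (x - r)\<close> and \<open>u = \<Sum> 1 / (x - r)\<^sup>2 = - w'\<close>.
\<close>

lemma root_poly_log_derivs:
  assumes "x \<notin> set rs"
  defines "w \<equiv> (\<Sum>r\<leftarrow>rs. 1 / (x - r))" and "u \<equiv> (\<Sum>r\<leftarrow>rs. 1 / (x - r)\<^sup>2)"
  shows "poly (pderiv (root_poly rs)) x = poly (root_poly rs) x * w"
    and "poly (pderiv (pderiv (root_poly rs))) x = poly (root_poly rs) x * (w\<^sup>2 - u)"
proof -
  define W where "W rs = (\<Sum>r\<leftarrow>rs. 1 / (x - r))" for rs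
  define U where "U rs = (\<Sum>r\<leftarrow>rs. 1 / (x - r)\<^sup>2)" for rs
  have *: "poly (pderiv (root_poly rs)) x = poly (root_poly rs) x * W rs \<and>
           poly (pderiv (pderiv (root_poly rs))) x = poly (root_poly rs) x * ((W rs)\<^sup>2 - U rs)"
    using assms(1)
  proof (induction rs)
    case Nil
    then show ?case by (simp add: root_poly_def W_def U_def)
  next
    case (Cons r rs)
    define P where "P = root_poly rs"
    have P: "root_poly (r # rs) = [:- r, 1:] * P" by (simp add: root_poly_def P_def)
    have IH: "poly (pderiv P) x = poly P x * W rs"
      "poly (pderiv (pderiv P)) x = poly P x * ((W rs)\<^sup>2 - U rs)"
      using Cons unfolding P_def by auto
    have d1: "pderiv (root_poly (r # rs)) = P + [:- r, 1:] * pderiv P"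
      unfolding P pderiv_mult by (simp add: pderiv_pCons)
    have d2: "pderiv (pderiv (root_poly (r # rs))) = 2 * pderiv P + [:- r, 1:] * pderiv (pderiv P)"
      unfolding d1 pderiv_add pderiv_mult by (simp add: pderiv_pCons)
    have r: "x - r \<noteq> 0" using Cons.prems by auto
    define z where "z = 1 / (x - r)"
    have z: "(x - r) * z = 1" using r by (simp add: z_def)
    have W: "W (r # rs) = z + W rs" and U: "U (r # rs) = z\<^sup>2 + U rs"
      by (simp_all add: W_def U_def z_def power_one_over)
    have "poly P x + (x - r) * (poly P x * W rs)
        = poly P x * ((x - r) * z) + (x - r) * (poly P x * W rs)"
      by (simp add: z)
    also have "\<dots> = (x - r) * poly P x * (z + W rs)" by (simp add: algebra_simps)
    finally have 1: "poly P x + (x - r) * (poly P x * W rs) = (x - r) * poly P x * (z + W rs)" .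
    have "2 * (poly P x * W rs) + (x - r) * (poly P x * ((W rs)\<^sup>2 - U rs))
        = 2 * (poly P x * W rs) * ((x - r) * z) + (x - r) * (poly P x * ((W rs)\<^sup>2 - U rs))"
      by (simp add: z)
    also have "\<dots> = (x - r) * poly P x * ((z + W rs)\<^sup>2 - (z\<^sup>2 + U rs))"
      by (simp add: algebra_simps power2_eq_square)
    finally have 2: "2 * (poly P x * W rs) + (x - r) * (poly P x * ((W rs)\<^sup>2 - U rs))
        = (x - r) * poly P x * ((z + W rs)\<^sup>2 - (z\<^sup>2 + U rs))" .
    have "poly (pderiv (root_poly (r # rs))) x = poly P x + (x - r) * (poly P x * W rs)"
      unfolding d1 by (simp add: IH algebra_simps)
    moreover have "poly (pderiv (pderiv (root_poly (r # rs)))) x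
        = 2 * (poly P x * W rs) + (x - r) * (poly P x * ((W rs)\<^sup>2 - U rs))"
      unfolding d2 by (simp add: IH algebra_simps)
    moreover have "poly (root_poly (r # rs)) x = (x - r) * poly P x"
      unfolding P by (simp add: algebra_simps)
    ultimately show ?case
      using 1 2 by (simp add: W U)
  qed
  then show "poly (pderiv (root_poly rs)) x = poly (root_poly rs) x * w"
    and "poly (pderiv (pderiv (root_poly rs))) x = poly (root_poly rs) x * (w\<^sup>2 - u)"
    by (simp_all add: w_def u_def W_def U_def)
qed

text \<open>
  Polynomials with only real critical points have negative Schwarzian derivative: with \<open>w =
  p'' / p'\<close> the Schwarzian is \<open>w' - w\<^sup>2 / 2\<close>, and \<open>w'\<close> is
  minus a sum of squares over the critical points.
\<close>

lemma Schwarzian_neg: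
  assumes p: "pderiv p = smult k (root_poly rs)" and "k \<noteq> 0" "rs \<noteq> []"
    and "x \<in> I01" "x \<notin> set rs"
  shows "nderiv 1 (poly p) x \<noteq> 0" "Schwarzian (poly p) x < 0"
proof -
  define w where "w = (\<Sum>r\<leftarrow>rs. 1 / (x - r))"
  define u where "u = (\<Sum>r\<leftarrow>rs. 1 / (x - r)\<^sup>2)"
  define P where "P = k * poly (root_poly rs) x"
  have "poly (root_poly rs) x \<noteq> 0"
    using assms(5) unfolding root_poly_def by (induction rs) auto
  then have P: "P \<noteq> 0" using assms(2) by (simp add: P_def)
  have pd: "(pderiv ^^ 1) p = smult k (root_poly rs)"
    "(pderiv ^^ 2) p = smult k (pderiv (root_poly rs))"
    "(pderiv ^^ 3) p = smult k (pderiv (pderiv (root_poly rs)))"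
    by (simp_all only: numeral_2_eq_2 numeral_3_eq_3 One_nat_def funpow.simps o_apply id_apply
        p pderiv_smult)
  have d: "nderiv 1 (poly p) x = P" "nderiv 2 (poly p) x = P * w"
    "nderiv 3 (poly p) x = P * (w\<^sup>2 - u)"
    unfolding nderiv_poly[OF assms(4)] pd poly_smult root_poly_log_derivs[OF assms(5)]
      P_def w_def u_def
    by (simp_all only: mult.assoc)
  show "nderiv 1 (poly p) x \<noteq> 0" using d P by simp
  have "u > 0"
  proof -
    obtain r rs' where rs: "rs = r # rs'" using assms(3) by (cases rs) auto
    have "1 / (x - r)\<^sup>2 > 0" using assms(5) rs by simp
    moreover have "(\<Sum>r\<leftarrow>rs'. 1 / (x - r)\<^sup>2) \<ge> 0" by (intro sum_list_nonneg) auto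
    ultimately show ?thesis unfolding u_def rs by (simp add: add_pos_nonneg)
  qed
  moreover have "Schwarzian (poly p) x = (w\<^sup>2 - u) - 3 / 2 * w\<^sup>2"
    unfolding Schwarzian_def d using P by (simp add: power_mult_distrib)
  moreover have "0 \<le> w\<^sup>2" by simp
  ultimately show "Schwarzian (poly p) x < 0" by argo
qed

section \<open>Iterates and bimodal maps\<close>

lemma DERIV_funpow:
  fixes f :: "real \<Rightarrow> real"
  assumes d: "\<And>x. x \<in> I01 \<Longrightarrow> (f has_real_derivative f' x) (at x)"
    and f: "f ` I01 \<subseteq> I01" and x: "x \<in> I01"
  shows "(f ^^ n) x \<in> I01"
    and "((f ^^ n) has_real_derivative (\<Prod>i<n. f' ((f ^^ i) x))) (at x)"
proof -
  have "(f ^^ n) x \<in> I01 \<and> ((f ^^ n) has_real_derivative (\<Prod>i<n. f' ((f ^^ i) x))) (at x)"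
  proof (induction n)
    case 0
    then show ?case using x by (auto simp: id_def)
  next
    case (Suc n)
    then have "((\<lambda>x. f ((f ^^ n) x)) has_real_derivative
        f' ((f ^^ n) x) * (\<Prod>i<n. f' ((f ^^ i) x))) (at x)"
      using d by (intro DERIV_chain2) auto
    moreover have "f ((f ^^ n) x) \<in> I01" using Suc f by blast
    ultimately show ?case by (simp add: o_def mult.commute)
  qed
  then show "(f ^^ n) x \<in> I01"
    and "((f ^^ n) has_real_derivative (\<Prod>i<n. f' ((f ^^ i) x))) (at x)" by blast+
qed

lemma nderiv_funpow:
  assumes "\<And>x. x \<in> I01 \<Longrightarrow> (f has_real_derivative f' x) (at x)" "f ` I01 \<subseteq> I01" "x \<in> I01"
  shows "nderiv 1 (f ^^ n) x = (\<Prod>i<n. f' ((f ^^ i) x))"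
  using vector_derivative_I01[OF DERIV_funpow(2)[OF assms] assms(3)] by simp

lemma two_modal:
  assumes c: "0 < c1" "c1 < c2" "c2 < 1"
    and inc1: "strict_mono_on {0..c1} f"
    and dec: "monotone_on {c1..c2} (<) (\<lambda>x y. y < x) f"
    and inc2: "strict_mono_on {c2..1} f"
  shows "modal_at f [c1, c2]"
proof -
  have "\<forall>\<^sub>F y in at c1 within I01. f y \<le> f c1"
    unfolding eventually_at
  proof (intro exI[of _ "c2 - c1"] conjI ballI impI)
    fix y assume y: "y \<in> I01" "y \<noteq> c1 \<and> dist y c1 < c2 - c1"
    show "f y \<le> f c1"
    proof (cases "y < c1")
      case True
      then show ?thesis using strict_mono_onD[OF inc1, of y c1] y c by auto
    next
      case False
      then show ?thesis using monotone_onD[OF dec, of c1 y] y c by (auto simp: dist_real_def)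
    qed
  qed (use c in auto)
  moreover have "\<forall>\<^sub>F y in at c2 within I01. f c2 \<le> f y"
    unfolding eventually_at
  proof (intro exI[of _ "c2 - c1"] conjI ballI impI)
    fix y assume y: "y \<in> I01" "y \<noteq> c2 \<and> dist y c2 < c2 - c1"
    show "f c2 \<le> f y"
    proof (cases "y < c2")
      case True
      then show ?thesis using monotone_onD[OF dec, of y c2] y c by (auto simp: dist_real_def)
    next
      case False
      then show ?thesis using strict_mono_onD[OF inc2, of c2 y] y c by (auto simp: dist_real_def)
    qed
  qed (use c in auto)
  moreover have "strictly_monotone_on {0..<c1} f" "strictly_monotone_on {c1<..<c2} f"
    "strictly_monotone_on {c2<..1} f"
    unfolding strictly_monotone_on_def
    using monotone_on_subset[OF inc1, of "{0..<c1}"] monotone_on_subset[OF dec, of "{c1<..<c2}"]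
      monotone_on_subset[OF inc2, of "{c2<..1}"] by (auto simp: subset_eq)
  ultimately show ?thesis
    unfolding modal_at_def turning_point_def using c by auto
qed

section \<open>Two conjugate families of polynomials\<close>

text \<open>
  The parameter range is chosen so that the critical value of \<open>F a\<close> stays below
  \<open>1\<close>, lies to the left of the right-hand critical point at the lower end, and is
  mapped beyond the left-hand critical point at the upper end (\<open>crit_value_left_end\<close>,
  \<open>crit_value_right_end\<close>). Between the ends, every kneading sequence starting with R
  L and larger than all its proper tails is then realized.
\<close>

definition params :: "real set" where "params = {13/20..67/100}"

definition F :: "real \<Rightarrow> real \<Rightarrow> real" where "F a x = x * ((x\<^sup>2 - a) / (1 - a))\<^sup>2"
text \<open>
  \<open>F a\<close> has the form \<open>x h(x\<^sup>2)\<close> and \<open>G a\<close> the form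
  \<open>y h(y)\<^sup>2\<close>; this is what makes the conjugate of \<open>F a\<close> by
  \<open>x \<mapsto> x\<^sup>2\<close> analytic at \<open>0\<close>.
\<close>

definition G :: "real \<Rightarrow> real \<Rightarrow> real" where "G a y = y * ((y - a) / (1 - a)) ^ 4"
text \<open>
  This factor is what remains of \<open>F'(x)\<close> when \<open>sqrt (F x / x)\<close> is split
  off. The split-off part telescopes along orbits, and it is the only part that is small at the
  critical point \<open>c2\<close>.
\<close>

definition E :: "real \<Rightarrow> real \<Rightarrow> real" where "E a x = (5 * x\<^sup>2 - a) / (1 - a)"
text \<open>
  The turning points: \<open>c1 a\<close> is the maximum, with value \<open>crit_value a\<close>,
  and \<open>c2 a\<close> the minimum, with value \<open>0\<close>.
\<close>

definition c1 :: "real \<Rightarrow> real" where "c1 a = sqrt (a / 5)"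
definition c2 :: "real \<Rightarrow> real" where "c2 a = sqrt a"
definition crit_value :: "real \<Rightarrow> real" where "crit_value a = F a (c1 a)"

lemma G_square: "G a (x\<^sup>2) = (F a x)\<^sup>2"
  by (simp add: F_def G_def power_mult_distrib flip: power_mult)

lemma F_simps: "F a 0 = 0" "a \<noteq> 1 \<Longrightarrow> F a 1 = 1" "F a x \<ge> 0 \<longleftrightarrow> x \<ge> 0 \<or> x\<^sup>2 = a \<or> a = 1"
  by (auto simp: F_def zero_le_mult_iff)

lemma params_bounds:
  assumes "a \<in> params"
  shows "13/20 \<le> a" "a \<le> 67/100" "0 < a" "a < 1"
  using assms by (auto simp: params_def)

lemma crit_bounds:
  assumes a: "a \<in> params"
  shows "(c1 a)\<^sup>2 = a / 5" "(c2 a)\<^sup>2 = a" "36/100 \<le> c1 a" "c1 a \<le> 37/100" "4/5 \<le> c2 a" "c2 a < 1"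
proof -
  note ab = params_bounds[OF a]
  show "(c1 a)\<^sup>2 = a / 5" "(c2 a)\<^sup>2 = a" using ab by (auto simp: c1_def c2_def)
  show "36/100 \<le> c1 a" "4/5 \<le> c2 a"
    unfolding c1_def c2_def by (rule real_le_rsqrt; use ab in \<open>simp add: power2_eq_square\<close>)+
  show "c1 a \<le> 37/100"
    unfolding c1_def by (rule real_le_lsqrt) (use ab in \<open>simp_all add: power2_eq_square\<close>)
  show "c2 a < 1" using ab by (simp add: c2_def)
qed

lemma DERIV_F:
  assumes "a \<noteq> 1"
  shows "(F a has_real_derivative (x\<^sup>2 - a) / (1 - a) * E a x) (at x)"
proof -
  define u k where "u = (x\<^sup>2 - a) / (1 - a)" and "k = 1 / (1 - a)"
  have "(F a has_real_derivative u\<^sup>2 + x * (2 * u * (2 * x * k))) (at x)"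
    unfolding F_def[abs_def] u_def k_def using assms
    by (auto intro!: derivative_eq_intros)
  also have "u\<^sup>2 + x * (2 * u * (2 * x * k)) = u * (u + 4 * x\<^sup>2 * k)"
    by (simp add: algebra_simps power2_eq_square)
  also have "u + 4 * x\<^sup>2 * k = E a x"
    by (simp add: u_def k_def E_def flip: add_divide_distrib)
  finally show ?thesis by (simp add: u_def)
qed

lemma DERIV_G:
  assumes "a \<noteq> 1"
  shows "(G a has_real_derivative ((y - a) / (1 - a)) ^ 3 * ((5 * y - a) / (1 - a))) (at y)"
proof -
  define u k where "u = (y - a) / (1 - a)" and "k = 1 / (1 - a)"
  have "(G a has_real_derivative u ^ 4 + y * (4 * u ^ 3 * k)) (at y)"
    unfolding G_def[abs_def] u_def k_def using assms
    by (auto intro!: derivative_eq_intros)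
  also have "u ^ 4 + y * (4 * u ^ 3 * k) = u ^ 3 * (u + 4 * y * k)"
    by (simp add: power4_eq_xxxx power3_eq_cube algebra_simps)
  also have "u + 4 * y * k = (5 * y - a) / (1 - a)"
    by (simp add: u_def k_def flip: add_divide_distrib)
  finally show ?thesis by (simp add: u_def)
qed

lemma F_strict_mono_left:
  assumes a: "a \<in> params" shows "strict_mono_on {0..c1 a} (F a)"
proof (rule strict_mono_onI)
  note ab = params_bounds[OF a] and cb = crit_bounds[OF a]
  fix x y assume xy: "x \<in> {0..c1 a}" "y \<in> {0..c1 a}" "x < y"
  show "F a x < F a y"
  proof (rule DERIV_pos_imp_increasing_open[OF \<open>x < y\<close>])
    fix z assume z: "x < z" "z < y"
    have "z\<^sup>2 < (c1 a)\<^sup>2" using z xy by (intro power_strict_mono) auto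
    then have "(z\<^sup>2 - a) * (5 * z\<^sup>2 - a) > 0" using cb ab by (intro mult_neg_neg) auto
    then have "(z\<^sup>2 - a) / (1 - a) * E a z > 0" using ab by (simp add: E_def)
    then show "\<exists>D. (F a has_real_derivative D) (at z) \<and> 0 < D" using DERIV_F[of a z] ab by auto
  qed (use DERIV_F ab in \<open>auto intro!: DERIV_continuous_on DERIV_subset[OF DERIV_F]\<close>)
qed

lemma F_strict_mono_right:
  assumes a: "a \<in> params" shows "strict_mono_on {c2 a..1} (F a)"
proof (rule strict_mono_onI)
  note ab = params_bounds[OF a] and cb = crit_bounds[OF a]
  fix x y assume xy: "x \<in> {c2 a..1}" "y \<in> {c2 a..1}" "x < y"
  show "F a x < F a y"
  proof (rule DERIV_pos_imp_increasing_open[OF \<open>x < y\<close>])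
    fix z assume z: "x < z" "z < y"
    have "z\<^sup>2 > (c2 a)\<^sup>2" using z xy cb by (intro power_strict_mono) auto
    then have "(z\<^sup>2 - a) * (5 * z\<^sup>2 - a) > 0" using cb ab by (intro mult_pos_pos) auto
    then have "(z\<^sup>2 - a) / (1 - a) * E a z > 0" using ab by (simp add: E_def)
    then show "\<exists>D. (F a has_real_derivative D) (at z) \<and> 0 < D" using DERIV_F[of a z] ab by auto
  qed (use DERIV_F ab in \<open>auto intro!: DERIV_continuous_on DERIV_subset[OF DERIV_F]\<close>)
qed

lemma F_strict_antimono_middle:
  assumes a: "a \<in> params" shows "monotone_on {c1 a..c2 a} (<) (\<lambda>x y. y < x) (F a)"
proof (rule monotone_onI)
  note ab = params_bounds[OF a] and cb = crit_bounds[OF a]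
  fix x y assume xy: "x \<in> {c1 a..c2 a}" "y \<in> {c1 a..c2 a}" "x < y"
  show "F a y < F a x"
  proof (rule DERIV_neg_imp_decreasing_open[OF \<open>x < y\<close>])
    fix z assume z: "x < z" "z < y"
    have "z\<^sup>2 < (c2 a)\<^sup>2" "z\<^sup>2 > (c1 a)\<^sup>2"
      using z xy cb(3) by (auto intro!: power_strict_mono simp del: cb)
    then have "(z\<^sup>2 - a) * (5 * z\<^sup>2 - a) < 0" using cb ab by (intro mult_neg_pos) auto
    then have "(z\<^sup>2 - a) / (1 - a) * E a z < 0" using ab by (simp add: E_def divide_neg_pos)
    then show "\<exists>D. (F a has_real_derivative D) (at z) \<and> D < 0" using DERIV_F[of a z] ab by auto
  qed (use DERIV_F ab in \<open>auto intro!: DERIV_continuous_on DERIV_subset[OF DERIV_F]\<close>)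
qed

lemma crit_value_square: 
  assumes a: "a \<in> params" shows "(crit_value a)\<^sup>2 = a / 5 * (4 / 5 * (a / (1 - a))) ^ 4"
proof -
  have "(a / 5 - a) / (1 - a) = - (4 / 5 * (a / (1 - a)))" by (simp add: field_simps)
  then have "crit_value a = c1 a * (4 / 5 * (a / (1 - a)))\<^sup>2"
    unfolding crit_value_def F_def crit_bounds(1)[OF a] by simp
  then show ?thesis
    by (simp add: power_mult_distrib crit_bounds(1)[OF a] flip: power_mult)
qed

lemma crit_value_bounds: assumes a: "a \<in> params" shows "0 < crit_value a" "crit_value a < 1"
proof -
  note ab = params_bounds[OF a] and cb = crit_bounds[OF a]
  show "0 < crit_value a" using strict_mono_onD[OF F_strict_mono_left[OF a], of 0 "c1 a"] cb
    by (simp add: crit_value_def F_simps)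
  have "a / (1 - a) \<le> 67/33" using ab by (simp add: field_simps)
  then have "(4 / 5 * (a / (1 - a))) ^ 4 \<le> (4 / 5 * (67/33)) ^ 4"
    using ab by (intro power_mono mult_left_mono) auto
  then have "a / 5 * (4 / 5 * (a / (1 - a))) ^ 4 \<le> (67/100) / 5 * (4 / 5 * (67/33)) ^ 4"
    using ab by (intro mult_mono) auto
  also have "\<dots> < 1\<^sup>2" by (simp add: power_divide)
  finally show "crit_value a < 1" unfolding crit_value_square[OF a, symmetric] by (rule power_less_imp_less_base) simp
qed

lemma F_I01: assumes a: "a \<in> params" and x: "x \<in> I01" shows "F a x \<in> I01"
proof -
  note ab = params_bounds[OF a] and cb = crit_bounds[OF a]
  consider "x \<in> {0..c1 a}" | "x \<in> {c1 a..c2 a}" | "x \<in> {c2 a..1}" using x by fastforce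
  then have "F a x \<le> 1"
  proof cases
    case 1
    then have "F a x \<le> F a (c1 a)"
      using strict_mono_on_imp_mono_on[OF F_strict_mono_left[OF a]] by (auto simp: mono_on_def)
    then show ?thesis using crit_value_bounds[OF a] by (simp add: crit_value_def)
  next
    case 2
    then have "F a x \<le> F a (c1 a)"
      using monotone_onD[OF F_strict_antimono_middle[OF a], of "c1 a" x] by (cases "x = c1 a") auto
    then show ?thesis using crit_value_bounds[OF a] by (simp add: crit_value_def)
  next
    case 3
    then have "F a x \<le> F a 1"
      using strict_mono_on_imp_mono_on[OF F_strict_mono_right[OF a]] by (auto simp: mono_on_def)
    then show ?thesis using ab by (simp add: F_simps)
  qed
  then show ?thesis using x by (auto simp: F_simps)
qed

lemma F_c2: "a \<in> params \<Longrightarrow> F a (c2 a) = 0"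
  by (simp add: F_def crit_bounds)

text \<open>
  With \<open>crit_value_right_end\<close>: at the lower end of the parameter range the critical
  value is at most, and at the upper end at least, any point whose itinerary starts with R L.
\<close>

lemma crit_value_left_end: "crit_value (13/20) \<le> c2 (13/20)"
proof -
  have a: "13/20 \<in> params" by (simp add: params_def)
  have "(crit_value (13/20))\<^sup>2 \<le> (c2 (13/20))\<^sup>2"
    unfolding crit_value_square[OF a] crit_bounds(2)[OF a] by (simp add: power_divide)
  then show ?thesis using crit_bounds(5)[OF a] by (auto intro: power2_le_imp_le)
qed

lemma crit_value_right_end: "c2 (67/100) \<le> crit_value (67/100)" "c1 (67/100) \<le> F (67/100) (crit_value (67/100))"
proof -
  let ?a = "67/100 :: real"
  have a: "?a \<in> params" by (simp add: params_def)
  have v2: "(crit_value ?a)\<^sup>2 = 67/500 * (4/5 * (67/33)) ^ 4" unfolding crit_value_square[OF a] by simp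
  have "(c2 ?a)\<^sup>2 \<le> (crit_value ?a)\<^sup>2"
    unfolding v2 crit_bounds(2)[OF a] by (simp add: power_divide)
  then show "c2 ?a \<le> crit_value ?a" using crit_value_bounds[OF a] by (auto intro: power2_le_imp_le)
  have "(c1 ?a)\<^sup>2 \<le> (F ?a (crit_value ?a))\<^sup>2"
    unfolding F_def power_mult_distrib v2 crit_bounds(1)[OF a] by (simp add: power_divide)
  moreover have "F ?a (crit_value ?a) \<ge> 0" using F_I01[OF a, of "crit_value ?a"] crit_value_bounds[OF a] by auto
  ultimately show "c1 ?a \<le> F ?a (crit_value ?a)" by (auto intro: power2_le_imp_le)
qed

text \<open>
  Together with \<open>F_ge\<close>: near the fixed point \<open>0\<close> one step multiplies the
  distance to \<open>0\<close> by a factor between \<open>13/4\<close> and \<open>33/8\<close>,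
  and by \<open>abs_E_deep\<close> and \<open>abs_E_left_le\<close> the factor \<open>E\<close> is
  between \<open>8/5\<close> and \<open>67/33\<close>, roughly the square root. The two
  inequalities \<open>(8/5)^4 > 33/8\<close> and \<open>(67/33)^4 < (13/4)^3\<close> between these
  constants decide the fate of the two maps.
\<close>

lemma F_le: assumes a: "a \<in> params" and x: "x \<in> I01" shows "F a x \<le> 33/8 * x"
proof -
  note ab = params_bounds[OF a]
  have x2: "0 \<le> x\<^sup>2" "x\<^sup>2 \<le> 1" using x by (auto simp: power_le_one)
  have "\<bar>(x\<^sup>2 - a) / (1 - a)\<bar> \<le> 67/33"
  proof -
    have "\<bar>x\<^sup>2 - a\<bar> \<le> 67/33 * (1 - a)" using x2 ab by - (rule abs_leI; argo)
    then show ?thesis using ab by (simp add: abs_divide pos_divide_le_eq)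
  qed
  then have "((x\<^sup>2 - a) / (1 - a))\<^sup>2 \<le> (67/33)\<^sup>2"
    using abs_le_square_iff[of "(x\<^sup>2 - a) / (1 - a)" "67/33"] by simp
  also have "\<dots> \<le> (33/8 :: real)" by (simp add: power_divide)
  finally have "((x\<^sup>2 - a) / (1 - a))\<^sup>2 * x \<le> 33/8 * x" using x by (intro mult_right_mono) auto
  then show ?thesis by (simp add: F_def mult.commute)
qed

lemma F_ge: assumes a: "a \<in> params" and x: "0 \<le> x" "x \<le> 1/8" shows "13/4 * x \<le> F a x"
proof -
  note ab = params_bounds[OF a]
  have "x\<^sup>2 \<le> (1/8)\<^sup>2" using x by (intro power_mono) auto
  then have x2: "0 \<le> x\<^sup>2" "x\<^sup>2 \<le> 1/64" by (auto simp: power_divide)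
  have "181/100 \<le> (a - x\<^sup>2) / (1 - a)" using x2 ab by (simp add: pos_le_divide_eq)
  then have "(181/100)\<^sup>2 \<le> ((a - x\<^sup>2) / (1 - a))\<^sup>2" by (intro power_mono) auto
  moreover have "((a - x\<^sup>2) / (1 - a))\<^sup>2 = ((x\<^sup>2 - a) / (1 - a))\<^sup>2"
    by (simp add: power_divide power2_commute)
  moreover have "13/4 \<le> (181/100 :: real)\<^sup>2" by (simp add: power_divide)
  ultimately have "13/4 \<le> ((x\<^sup>2 - a) / (1 - a))\<^sup>2" by linarith
  then have "13/4 * x \<le> ((x\<^sup>2 - a) / (1 - a))\<^sup>2 * x" using x by (intro mult_right_mono) auto
  then show ?thesis by (simp add: F_def mult.commute)
qed

text \<open>
  A point that stays in the left branch for two consecutive steps is close to \<open>0\<close>.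
\<close>

lemma deep_left:
  assumes a: "a \<in> params" and x: "0 \<le> x" "x \<le> c1 a" "F a x \<le> c1 a" shows "x \<le> 1/8"
proof (rule ccontr)
  assume "\<not> x \<le> 1/8"
  then have "F a (1/8) < F a x"
    using strict_mono_onD[OF F_strict_mono_left[OF a], of "1/8" x] crit_bounds[OF a] x by auto
  moreover have "13/4 * (1/8) \<le> F a (1/8)" using F_ge[OF a, of "1/8"] by simp
  ultimately show False using x crit_bounds[OF a] by simp
qed

lemma abs_E_deep:
  assumes a: "a \<in> params" and x: "0 \<le> x" "x \<le> 1/8" shows "8/5 \<le> \<bar>E a x\<bar>"
proof -
  note ab = params_bounds[OF a]
  have "x\<^sup>2 \<le> (1/8)\<^sup>2" using x by (intro power_mono) auto
  then have x2: "0 \<le> x\<^sup>2" "x\<^sup>2 \<le> 1/64" by (auto simp: power_divide)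
  have "8/5 * (1 - a) \<le> \<bar>5 * x\<^sup>2 - a\<bar>" using x2 ab by simp
  then show ?thesis using ab by (simp add: E_def abs_divide pos_le_divide_eq)
qed

lemma abs_E_left_le:
  assumes a: "a \<in> params" and x: "0 \<le> x" "x \<le> c1 a" shows "\<bar>E a x\<bar> \<le> 67/33"
proof -
  note ab = params_bounds[OF a]
  have "x\<^sup>2 \<le> (c1 a)\<^sup>2" using x by (intro power_mono) auto
  then have x2: "0 \<le> x\<^sup>2" "x\<^sup>2 \<le> a / 5" by (auto simp: crit_bounds[OF a])
  have "\<bar>5 * x\<^sup>2 - a\<bar> \<le> 67/33 * (1 - a)" using x2 ab by - (rule abs_leI; argo)
  then show ?thesis using ab by (simp add: E_def abs_divide pos_divide_le_eq)
qed

text \<open>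
  The factor \<open>E\<close> is monotone on the left branch, so a lower bound at \<open>x\<close>
  in terms of the distance to the critical point holds at every point to the left of
  \<open>x\<close>.
\<close>

lemma abs_E_left_ge:
  assumes a: "a \<in> params" and x: "0 \<le> z" "z \<le> x" "x \<le> c1 a" shows "c1 a - x \<le> \<bar>E a z\<bar>"
proof -
  note ab = params_bounds[OF a] and cb = crit_bounds[OF a]
  have "z\<^sup>2 \<le> x\<^sup>2" using x by (intro power_mono) auto
  moreover have "(c1 a)\<^sup>2 - x\<^sup>2 = (c1 a - x) * (c1 a + x)" by (simp add: power2_eq_square algebra_simps)
  moreover have "(c1 a - x) * (1/5) \<le> (c1 a - x) * (c1 a + x)"
    using x cb by (intro mult_left_mono) auto
  ultimately have "c1 a - x \<le> a - 5 * z\<^sup>2" using cb(1) by argo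
  also have "\<dots> \<le> \<bar>5 * z\<^sup>2 - a\<bar>" by simp
  also have "\<dots> \<le> \<bar>5 * z\<^sup>2 - a\<bar> / (1 - a)" using ab by (simp add: pos_le_divide_eq mult_left_le)
  finally show ?thesis using ab by (simp add: E_def abs_divide)
qed

lemma abs_E_right_ge:
  assumes a: "a \<in> params" and x: "c2 a \<le> x" shows "1 \<le> \<bar>E a x\<bar>"
proof -
  note ab = params_bounds[OF a] and cb = crit_bounds[OF a]
  have "(c2 a)\<^sup>2 \<le> x\<^sup>2" using x cb by (intro power_mono) auto
  then have "1 - a \<le> \<bar>5 * x\<^sup>2 - a\<bar>" using ab cb by auto
  then show ?thesis using ab by (simp add: E_def abs_divide pos_le_divide_eq)
qed

lemma abs_E_le:
  assumes a: "a \<in> params" and x: "x \<in> I01" shows "\<bar>E a x\<bar> \<le> 14"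
proof -
  note ab = params_bounds[OF a]
  have x2: "0 \<le> x\<^sup>2" "x\<^sup>2 \<le> 1" using x by (auto simp: power_le_one)
  have "\<bar>5 * x\<^sup>2 - a\<bar> \<le> 14 * (1 - a)" using x2 ab by - (rule abs_leI; argo)
  then show ?thesis using ab by (simp add: E_def abs_divide pos_divide_le_eq)
qed

lemma F_lipschitz:
  assumes a: "a \<in> params" and x: "x \<in> I01" "y \<in> I01" shows "\<bar>F a x - F a y\<bar> \<le> 32 * \<bar>x - y\<bar>"
proof -
  note ab = params_bounds[OF a]
  have "norm (F a x - F a y) \<le> 32 * norm (x - y)"
  proof (rule field_differentiable_bound[of I01 "F a" "\<lambda>x. (x\<^sup>2 - a) / (1 - a) * E a x"])
    fix z assume z: "z \<in> I01"
    show "(F a has_field_derivative (z\<^sup>2 - a) / (1 - a) * E a z) (at z within I01)"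
      using ab by (intro has_field_derivative_at_within[OF DERIV_F]) auto
    have z2: "0 \<le> z\<^sup>2" "z\<^sup>2 \<le> 1" using z by (auto simp: power_le_one)
    have "\<bar>z\<^sup>2 - a\<bar> \<le> 67/33 * (1 - a)" using z2 ab by - (rule abs_leI; argo)
    then have "\<bar>(z\<^sup>2 - a) / (1 - a)\<bar> \<le> 67/33" using ab by (simp add: abs_divide pos_divide_le_eq)
    then have "\<bar>(z\<^sup>2 - a) / (1 - a)\<bar> * \<bar>E a z\<bar> \<le> 67/33 * 14"
      using abs_E_le[OF a z] by (intro mult_mono) auto
    then show "norm ((z\<^sup>2 - a) / (1 - a) * E a z) \<le> 32"
      unfolding real_norm_def abs_mult by linarith
  qed (use x in auto)
  then show ?thesis by simp
qed

lemma F_poly: "F a = poly (smult (1 / (1 - a)\<^sup>2) [:0, a\<^sup>2, 0, - 2 * a, 0, 1:])"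
proof
  fix x
  have "F a x = 1 / (1 - a)\<^sup>2 * (x * (x\<^sup>2 - a)\<^sup>2)" by (simp add: F_def power_divide)
  also have "x * (x\<^sup>2 - a)\<^sup>2 = poly [:0, a\<^sup>2, 0, - 2 * a, 0, 1:] x"
    by (simp add: algebra_simps power2_eq_square)
  finally show "F a x = poly (smult (1 / (1 - a)\<^sup>2) [:0, a\<^sup>2, 0, - 2 * a, 0, 1:]) x"
    unfolding poly_smult .
qed

lemma G_poly: "G a = poly (smult (1 / (1 - a) ^ 4) [:0, a ^ 4, - 4 * a ^ 3, 6 * a\<^sup>2, - 4 * a, 1:])"
proof
  fix y
  have "G a y = 1 / (1 - a) ^ 4 * (y * (y - a) ^ 4)" by (simp add: G_def power_divide)
  also have "y * (y - a) ^ 4 = poly [:0, a ^ 4, - 4 * a ^ 3, 6 * a\<^sup>2, - 4 * a, 1:] y"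
    by (simp add: algebra_simps eval_nat_numeral)
  finally show "G a y
      = poly (smult (1 / (1 - a) ^ 4) [:0, a ^ 4, - 4 * a ^ 3, 6 * a\<^sup>2, - 4 * a, 1:]) y"
    unfolding poly_smult .
qed

text \<open>
  The squaring conjugacy is increasing, so it carries the monotone branches of \<open>F a\<close>
  to those of \<open>G a\<close>.
\<close>

lemma G_monotone:
  assumes "a \<in> params" 
  shows "strict_mono_on {0..(c1 a)\<^sup>2} (G a)"
    "monotone_on {(c1 a)\<^sup>2..(c2 a)\<^sup>2} (<) (\<lambda>x y. y < x) (G a)"
    "strict_mono_on {(c2 a)\<^sup>2..1} (G a)"
proof -
  note cb = crit_bounds[OF assms]
  have G: "G a y = (F a (sqrt y))\<^sup>2" if "0 \<le> y" for y
    using G_square[of a "sqrt y"] that by simp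
  have c: "sqrt ((c1 a)\<^sup>2) = c1 a" "sqrt ((c2 a)\<^sup>2) = c2 a"
    using cb(3,5) by (auto simp del: cb)
  have sq: "sqrt y \<in> {sqrt u..sqrt w}" if "y \<in> {u..w}" for y u w using that by auto
  have less: "G a x < G a y" if "F a (sqrt x) < F a (sqrt y)" "0 \<le> x" "0 \<le> y" for x y
    using that by (simp add: G power_strict_mono F_simps)
  show "strict_mono_on {0..(c1 a)\<^sup>2} (G a)"
  proof (rule strict_mono_onI)
    fix x y assume "x \<in> {0..(c1 a)\<^sup>2}" "y \<in> {0..(c1 a)\<^sup>2}" "x < y"
    then show "G a x < G a y"
      using sq[of _ 0 "(c1 a)\<^sup>2"] c
      by (intro less strict_mono_onD[OF F_strict_mono_left[OF assms]]) auto
  qed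
  show "monotone_on {(c1 a)\<^sup>2..(c2 a)\<^sup>2} (<) (\<lambda>x y. y < x) (G a)"
  proof (rule monotone_onI)
    fix x y assume xy: "x \<in> {(c1 a)\<^sup>2..(c2 a)\<^sup>2}" "y \<in> {(c1 a)\<^sup>2..(c2 a)\<^sup>2}" "x < y"
    moreover from xy have "0 \<le> x" by (auto intro: order_trans[OF zero_le_power2])
    moreover from this xy have "0 \<le> y" by simp
    ultimately show "G a y < G a x"
      using sq[of x "(c1 a)\<^sup>2" "(c2 a)\<^sup>2"] sq[of y "(c1 a)\<^sup>2" "(c2 a)\<^sup>2"] c
      by (intro less monotone_onD[OF F_strict_antimono_middle[OF assms]]) auto
  qed
  show "strict_mono_on {(c2 a)\<^sup>2..1} (G a)"
  proof (rule strict_mono_onI)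
    fix x y assume xy: "x \<in> {(c2 a)\<^sup>2..1}" "y \<in> {(c2 a)\<^sup>2..1}" "x < y"
    moreover from xy have "0 \<le> x" by (auto intro: order_trans[OF zero_le_power2])
    moreover from this xy have "0 \<le> y" by simp
    ultimately show "G a x < G a y"
      using sq[of x "(c2 a)\<^sup>2" 1] sq[of y "(c2 a)\<^sup>2" 1] c
      by (intro less strict_mono_onD[OF F_strict_mono_right[OF assms]]) auto
  qed
qed

lemma G_I01: "a \<in> params \<Longrightarrow> y \<in> I01 \<Longrightarrow> G a y \<in> I01"
  using G_square[of a "sqrt y"] F_I01[of a "sqrt y"] by (auto simp: power_le_one)

lemma modal_F: "a \<in> params \<Longrightarrow> modal_at (F a) [c1 a, c2 a]"
  using F_strict_mono_left F_strict_antimono_middle F_strict_mono_right crit_bounds[of a]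
  by (intro two_modal) auto

lemma modal_G:
  assumes a: "a \<in> params" shows "modal_at (G a) [(c1 a)\<^sup>2, (c2 a)\<^sup>2]"
proof (rule two_modal)
  show "0 < (c1 a)\<^sup>2" "(c1 a)\<^sup>2 < (c2 a)\<^sup>2" "(c2 a)\<^sup>2 < 1"
    unfolding crit_bounds(1,2)[OF a] using params_bounds[OF a] by simp_all
qed (rule G_monotone[OF a])+

lemmas Crit_F = Crit_eq[OF modal_F] and Crit_G = Crit_eq[OF modal_G]

lemma S_multimodal_F: assumes a: "a \<in> params" shows "S_multimodal (F a)"
proof -
  note ab = params_bounds[OF a] and cb = crit_bounds[OF a]
  let ?p = "smult (1 / (1 - a)\<^sup>2) [:0, a\<^sup>2, 0, - 2 * a, 0, 1:]"
  let ?rs = "[c2 a, - c2 a, c1 a, - c1 a]"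
  have d: "pderiv ?p = smult (5 / (1 - a)\<^sup>2) (root_poly ?rs)"
  proof -
    have "root_poly [c2 a, - c2 a, c1 a, - c1 a] = [:- (c2 a)\<^sup>2, 0, 1:] * [:- (c1 a)\<^sup>2, 0, 1:]"
      by (simp add: root_poly_def power2_eq_square algebra_simps)
    then show ?thesis
      unfolding cb by (simp add: pderiv_smult pderiv_pCons power2_eq_square)
  qed
  have "x \<notin> set ?rs" if "x \<in> I01 - Crit (F a)" for x
    using that Crit_F[OF a] cb by auto
  then have "\<forall>x\<in>I01 - Crit (F a). nderiv 1 (F a) x \<noteq> 0 \<and> Schwarzian (F a) x < 0"
    using Schwarzian_neg[OF d] ab unfolding F_poly by auto
  moreover have "multimodal (F a)"
    unfolding multimodal_def l_modal_def
  proof (intro exI[of _ 2] conjI exI[of _ "[c1 a, c2 a]"] modal_F a)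
    show "continuous_on I01 (F a)" unfolding F_poly by (intro continuous_intros)
    show "F a ` I01 \<subseteq> I01" using F_I01[OF a] by blast
  qed (use ab in \<open>auto simp: F_simps\<close>)
  ultimately show ?thesis
    unfolding S_multimodal_def using C_k_poly unfolding F_poly by blast
qed

lemma S_multimodal_G: assumes a: "a \<in> params" shows "S_multimodal (G a)"
proof -
  note ab = params_bounds[OF a] and cb = crit_bounds[OF a]
  let ?p = "smult (1 / (1 - a) ^ 4) [:0, a ^ 4, - 4 * a ^ 3, 6 * a\<^sup>2, - 4 * a, 1:]"
  let ?rs = "[a, a, a, a / 5]"
  have d: "pderiv ?p = smult (5 / (1 - a) ^ 4) (root_poly ?rs)"
    by (simp add: root_poly_def pderiv_smult pderiv_pCons eval_nat_numeral algebra_simps)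
  have "x \<notin> set ?rs" if "x \<in> I01 - Crit (G a)" for x
    using that Crit_G[OF a] cb by auto
  then have "\<forall>x\<in>I01 - Crit (G a). nderiv 1 (G a) x \<noteq> 0 \<and> Schwarzian (G a) x < 0"
    using Schwarzian_neg[OF d] ab unfolding G_poly by auto
  moreover have "multimodal (G a)"
    unfolding multimodal_def l_modal_def
  proof (intro exI[of _ 2] conjI exI[of _ "[(c1 a)\<^sup>2, (c2 a)\<^sup>2]"] modal_G a)
    show "continuous_on I01 (G a)" unfolding G_poly by (intro continuous_intros)
    show "G a ` I01 \<subseteq> I01" using G_I01[OF a] by blast
  qed (use ab in \<open>auto simp: G_def\<close>)
  ultimately show ?thesis
    unfolding S_multimodal_def using C_k_poly unfolding G_poly by blast
qed

section \<open>The kneading sequence\<close>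

text \<open>
  The kneading sequence \<open>kneading\<close> has value \<open>True\<close> for the right branch
  R and \<open>False\<close> for the left branch L. It starts with R L. Stage \<open>k\<close>
  occupies the times from \<open>stage_start k\<close> to \<open>stage_start (Suc k) - 1\<close>:
  a copy of an initial segment of \<open>kneading\<close>, of length \<open>copy_len k\<close>,
  followed by a run of L. The stages grow by a factor \<open>3/2\<close>, so that the run in stage
  \<open>k\<close> takes about half of the time elapsed before it. This ratio is the crucial
  quantity: during the run the critical orbit is exponentially close to \<open>0\<close>, in a way
  that \<open>F\<close> can afford and \<open>G\<close> cannot. The copies make the critical point
  recurrent; they are so short that they have no influence on growth rates.
\<close>

fun stage_start :: "nat \<Rightarrow> nat" where
  "stage_start 0 = 2"
| "stage_start (Suc k) = stage_start k + stage_start k div 2 + 5"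

definition stage :: "nat \<Rightarrow> nat" where "stage n = (LEAST k. n < stage_start (Suc k))"

text \<open>
  The copied segment has length \<open>stage_start r\<close> for the largest \<open>r\<close> such
  that this length is at most about the square root of \<open>k\<close>. The length is chosen
  among the \<open>stage_start r\<close> since \<open>kneading (stage_start r)\<close> is R,
  whereas the copy is followed by L: so the copy, continued, is smaller than
  \<open>kneading\<close>.
\<close>

definition copy_index :: "nat \<Rightarrow> nat" where
  "copy_index k = (GREATEST r. (stage_start r + 1)\<^sup>2 \<le> k + 9)"

definition copy_len :: "nat \<Rightarrow> nat" where "copy_len k = stage_start (copy_index k)"

lemma strict_mono_stage_start: "strict_mono stage_start"
  by (rule strict_monoI_Suc) simp

lemma stage_start_lower: "2 * k + 2 \<le> stage_start k"
  by (induction k) auto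

lemma copy_index: "(stage_start (copy_index k) + 1)\<^sup>2 \<le> k + 9"
  and copy_index_ge: "(stage_start r + 1)\<^sup>2 \<le> k + 9 \<Longrightarrow> r \<le> copy_index k"
proof -
  have bound: "r \<le> k + 9" if "(stage_start r + 1)\<^sup>2 \<le> k + 9" for r
  proof -
    have "r \<le> stage_start r + 1" using stage_start_lower[of r] by linarith
    also have "\<dots> \<le> (stage_start r + 1)\<^sup>2" unfolding power2_eq_square by simp
    also note that
    finally show ?thesis .
  qed
  have "(stage_start 0 + 1)\<^sup>2 \<le> k + 9" by (simp add: power2_eq_square)
  then show "(stage_start (copy_index k) + 1)\<^sup>2 \<le> k + 9"
    unfolding copy_index_def using bound by (rule GreatestI_nat)
  show "r \<le> copy_index k" if "(stage_start r + 1)\<^sup>2 \<le> k + 9"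
    unfolding copy_index_def using that bound by (rule Greatest_le_nat)
qed

lemma copy_len_ge_2: "2 \<le> copy_len k"
  unfolding copy_len_def using stage_start_lower[of "copy_index k"] by simp

lemma copy_len_square: "(copy_len k + 1)\<^sup>2 \<le> k + 9"
  unfolding copy_len_def by (rule copy_index)

text \<open>
  Twice the length of the copy lies strictly inside the stage; \<open>tails_fall_below\<close>
  compares a tail that starts within the copy with \<open>kneading\<close> over that length.
\<close>

lemma copy_len_gap: "stage_start k + 3 * copy_len k \<le> stage_start (Suc k)"
proof -
  let ?p = "copy_len k"
  obtain q where q: "?p = Suc q" using copy_len_ge_2[of k] by (cases ?p) auto
  have "q \<le> q * q" using copy_len_ge_2[of k] q by simp
  moreover have "q * q + 4 * q \<le> k + 5"
    using copy_len_square[of k] unfolding q by (simp add: power2_eq_square)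
  ultimately have "5 * q \<le> k + 5" by linarith
  then have "3 * ?p \<le> k + 6" using copy_len_ge_2[of k] unfolding q by simp
  also have "\<dots> \<le> stage_start k div 2 + 5" using stage_start_lower[of k] by linarith
  finally show ?thesis by (simp only: stage_start.simps add_le_cancel_left add.assoc)
qed

lemma stage_eq: "stage_start k \<le> n \<Longrightarrow> n < stage_start (Suc k) \<Longrightarrow> stage n = k"
  unfolding stage_def
proof (rule Least_equality)
  fix m assume n: "stage_start k \<le> n" "n < stage_start (Suc m)"
  then have "stage_start k < stage_start (Suc m)" by simp
  then show "k \<le> m" using strict_mono_less[OF strict_mono_stage_start, of k "Suc m"] by linarith
qed

lemma stage:
  assumes "2 \<le> n" shows "stage_start (stage n) \<le> n" "n < stage_start (Suc (stage n))"
proof -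
  have "n < stage_start (Suc n)" using stage_start_lower[of "Suc n"] by simp
  then show "n < stage_start (Suc (stage n))" unfolding stage_def by (rule LeastI)
  show "stage_start (stage n) \<le> n"
  proof (cases "stage n")
    case (Suc k)
    then show ?thesis
      using not_less_Least[of k "\<lambda>k. n < stage_start (Suc k)"] unfolding stage_def by simp
  qed (use assms in simp)
qed

function kneading :: "nat \<Rightarrow> bool" where
  "kneading n = (if n < 2 then n = 0
          else if n - stage_start (stage n) < copy_len (stage n) then kneading (n - stage_start (stage n)) else False)"
  by pat_completeness auto
termination
proof (relation "Wellfounded.measure id")
  fix n :: nat assume "\<not> n < 2"
  moreover have "1 \<le> stage_start (stage n)" using stage_start_lower[of "stage n"] by simp
  ultimately show "(n - stage_start (stage n), n) \<in> Wellfounded.measure id" by simp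
qed simp

declare kneading.simps[simp del] stage_start.simps(2)[simp del]

lemma kneading_0: "kneading 0" by (simp add: kneading.simps)

lemma kneading_copy: "j < copy_len k \<Longrightarrow> kneading (stage_start k + j) = kneading j"
  using stage_eq[of k "stage_start k + j"] copy_len_gap[of k] stage_start_lower[of k] by (subst kneading.simps) simp

lemma kneading_run: "copy_len k \<le> j \<Longrightarrow> stage_start k + j < stage_start (Suc k) \<Longrightarrow> \<not> kneading (stage_start k + j)"
  using stage_eq[of k "stage_start k + j"] stage_start_lower[of k] by (subst kneading.simps) simp

lemma kneading_stage_start: "kneading (stage_start k)"
  using kneading_copy[of 0 k] copy_len_ge_2[of k] kneading_0 by simp

lemma not_kneading_1: "\<not> kneading 1" by (simp add: kneading.simps)

text \<open>
  The tail of \<open>kneading\<close> at \<open>n\<close> is lexicographically smaller than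
  \<open>kneading\<close> (with L < R), and the first difference occurs at position
  \<open>d\<close>.
\<close>

definition falls_below :: "nat \<Rightarrow> nat \<Rightarrow> bool" where
  "falls_below n d \<longleftrightarrow> (\<forall>i<d. kneading (n + i) = kneading i) \<and> \<not> kneading (n + d) \<and> kneading d"

text \<open>
  \<open>kneading\<close> is larger than each of its proper tails, which makes it realizable, and
  a tail differs from \<open>kneading\<close> early, which keeps the critical orbit away from the
  critical point. A tail starting in the middle of a copy either differs from
  \<open>kneading\<close> inside the copy, by induction, or agrees with \<open>kneading\<close> up
  to the end of the copy; in the latter case it continues with L, and \<open>kneading\<close> has
  an R soon afterwards.
\<close>

lemma tails_fall_below:
  assumes "1 \<le> n"
  shows "\<exists>d\<le>copy_len (stage n). falls_below n d"
  using assms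
proof (induction n rule: less_induct)
  case (less n)
  show ?case
  proof (cases "n = 1")
    case True
    then have "falls_below n 0" using kneading_0 not_kneading_1 by (simp add: falls_below_def)
    then show ?thesis by blast
  next
    case n1: False
  define k j p where "k = stage n" and "j = n - stage_start k" and "p = copy_len k"
  have n: "n = stage_start k + j" "stage_start k + j < stage_start (Suc k)" using stage[of n] less.prems n1 by (auto simp: j_def k_def)
  have gap: "stage_start k + 3 * p \<le> stage_start (Suc k)" unfolding p_def by (rule copy_len_gap)
  have p: "1 \<le> p" "kneading p" using copy_len_ge_2[of k] kneading_stage_start by (auto simp: p_def copy_len_def)
  consider "p \<le> j" | "j = 0" | "1 \<le> j" "j < p" by linarith
  then show ?thesis
  proof cases
    case 1
    then have "falls_below n 0" using kneading_run n kneading_0 by (auto simp: falls_below_def p_def)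
    then show ?thesis by blast
  next
    case 2
    then have "falls_below n p"
      using kneading_copy[of _ k] kneading_run[of k p] gap p n by (auto simp: falls_below_def p_def)
    then show ?thesis by (auto simp: p_def k_def)
  next
    case 3
    have "j < n" using n stage_start_lower[of k] by simp
    then obtain d' where d': "falls_below j d'" using less.IH 3 by blast
    show ?thesis
    proof (cases "j + d' < p")
      case True
      have "kneading (n + i) = kneading (j + i)" if "i \<le> d'" for i
        using kneading_copy[of "j + i" k] True that n by (simp add: p_def add.assoc)
      then have "falls_below n d'" using d' by (auto simp: falls_below_def)
      then show ?thesis using True by (intro exI[of _ d']) (auto simp: p_def k_def)
    next
      case False
      \<comment> \<open>The tail agrees with \<open>kneading\<close> up to the end of the copy;
        \<open>d\<close> is the place of the next R of \<open>kneading\<close>.\<close>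
      define d where "d = (LEAST d. p - j \<le> d \<and> kneading d)"
      have pj: "p - j \<le> p \<and> kneading p" using p by simp
      then have "p - j \<le> d \<and> kneading d" unfolding d_def by (rule LeastI)
      moreover have "d \<le> p" unfolding d_def by (rule Least_le[of _ p]) (rule pj)
      ultimately have d: "p - j \<le> d" "kneading d" "d \<le> p" by auto
      have no: "\<not> kneading i" if "p - j \<le> i" "i < d" for i
        using not_less_Least[of i "\<lambda>d. p - j \<le> d \<and> kneading d"] that by (auto simp: d_def)
      have run: "\<not> kneading (n + i)" if "p - j \<le> i" "i \<le> d" for i
        using kneading_run[of k "j + i"] that d 3 gap n by (simp add: p_def add.assoc)
      have "kneading (n + i) = kneading i" if "i < d" for i
      proof (cases "i < p - j")
        case True
        then have "kneading (n + i) = kneading (j + i)" using kneading_copy[of "j + i" k] n by (simp add: p_def add.assoc)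
        also have "\<dots> = kneading i" using d' True False by (simp add: falls_below_def)
        finally show ?thesis .
      next
        case False
        then show ?thesis using run no that by simp
      qed
      then have "falls_below n d" using run d by (auto simp: falls_below_def)
      then show ?thesis using d by (auto simp: p_def k_def)
    qed
  qed
  qed
qed

text \<open>
  An exponent for the deviation of the factor \<open>E\<close> at time \<open>n - 1\<close> from
  its size near \<open>0\<close>: \<open>E\<close> is at most \<open>32\<close> to this power
  smaller and \<open>14\<close> to this power larger. It vanishes only if the symbols at the times
  \<open>n - 1\<close> and \<open>n\<close> are both L, so that the orbit is close to
  \<open>0\<close>. At time \<open>1\<close>, before the first stage, \<open>stage\<close> is
  \<open>0\<close> and the truncated subtraction gives the value for the start of stage
  \<open>0\<close>.
\<close>

definition loss :: "nat \<Rightarrow> nat" where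
  "loss n = (if n - stage_start (stage n) \<le> copy_len (stage n) then copy_len (stage n) + 2 else 0)"

lemma loss_eq_0:
  assumes "loss (Suc i) = 0" shows "\<not> kneading i" "\<not> kneading (Suc i)"
proof -
  define k where "k = stage (Suc i)"
  have "stage 1 = 0" unfolding stage_def by (rule Least_equality) (auto simp: stage_start.simps)
  then have "2 \<le> Suc i" using assms by (cases i) (auto simp: loss_def split: if_splits)
  note k = stage[OF this, folded k_def]
  have l: "copy_len k < Suc i - stage_start k" using assms by (auto simp: loss_def k_def split: if_splits)
  show "\<not> kneading (Suc i)" using kneading_run[of k "Suc i - stage_start k"] k l by simp
  show "\<not> kneading i" using kneading_run[of k "i - stage_start k"] k l by simp
qed

lemma loss_stage_sum: "(\<Sum>n=stage_start k..<stage_start (Suc k). loss n) \<le> 2 * (k + 9)"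
proof -
  let ?p = "copy_len k"
  have gap: "stage_start k + ?p < stage_start (Suc k)" using copy_len_gap[of k] copy_len_ge_2[of k] by linarith
  have "(\<Sum>n=stage_start k..<stage_start (Suc k). loss n) = (\<Sum>n=stage_start k..stage_start k + ?p. ?p + 2)"
  proof (rule sum.mono_neutral_cong_right)
    have "loss n = (if n - stage_start k \<le> ?p then ?p + 2 else 0)" if "stage_start k \<le> n" "n < stage_start (Suc k)" for n
      using stage_eq[OF that] by (simp add: loss_def)
    then show "\<forall>n\<in>{stage_start k..<stage_start (Suc k)} - {stage_start k..stage_start k + ?p}. loss n = 0"
      and "\<And>n. n \<in> {stage_start k..stage_start k + ?p} \<Longrightarrow> loss n = ?p + 2"
      using gap by auto
  qed (use gap in auto)
  also have "\<dots> = (?p + 1) * (?p + 2)" by simp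
  also have "\<dots> \<le> 2 * (?p + 1)\<^sup>2" by (simp add: power2_eq_square)
  also have "\<dots> \<le> 2 * (k + 9)" using copy_len_square[of k] by simp
  finally show ?thesis .
qed

text \<open>
  The loss in stage \<open>k\<close> is at most quadratic in the length of the copy, hence linear
  in \<open>k\<close>, and the total loss is quadratic in \<open>k\<close>, whereas the elapsed
  time is exponential in \<open>k\<close>.
\<close>

lemma loss_sum:
  assumes "n < stage_start (Suc k)" shows "(\<Sum>i<n. loss (Suc i)) \<le> 2 * (k + 9)\<^sup>2"
proof -
  have total: "(\<Sum>i=1..<stage_start (Suc k). loss i) \<le> 2 * (k + 9)\<^sup>2" for k
  proof (induction k)
    case 0
    have "stage 1 = 0" unfolding stage_def by (rule Least_equality) (auto simp: stage_start.simps)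
    moreover have "copy_len 0 \<le> 2"
    proof -
      have "copy_len 0 + 1 \<le> 3"
        using copy_len_square[of 0] power2_le_imp_le[of "copy_len 0 + 1" 3] by simp
      then show ?thesis by simp
    qed
    ultimately have "loss 1 \<le> 4" by (simp add: loss_def)
    moreover have "(\<Sum>i=1..<stage_start (Suc 0). loss i) = loss 1 + (\<Sum>i=stage_start 0..<stage_start (Suc 0). loss i)"
      by (subst sum.atLeast_Suc_lessThan) (auto simp: stage_start.simps numeral_2_eq_2)
    ultimately show ?case using loss_stage_sum[of 0] by simp
  next
    case (Suc k)
    have "(\<Sum>i=1..<stage_start (Suc (Suc k)). loss i)
        = (\<Sum>i=1..<stage_start (Suc k). loss i) + (\<Sum>i=stage_start (Suc k)..<stage_start (Suc (Suc k)). loss i)"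
      using stage_start_lower[of "Suc k"] strict_mono_less_eq[OF strict_mono_stage_start, of "Suc k" "Suc (Suc k)"]
      by (intro sum.atLeastLessThan_concat[symmetric]) auto
    also have "\<dots> \<le> 2 * (k + 9)\<^sup>2 + 2 * (Suc k + 9)" using Suc loss_stage_sum by (intro add_mono)
    also have "\<dots> \<le> 2 * (Suc k + 9)\<^sup>2" by (simp add: power2_eq_square algebra_simps)
    finally show ?case .
  qed
  have "(\<Sum>i<n. loss (Suc i)) = (\<Sum>i=1..<Suc n. loss i)"
    unfolding lessThan_atLeast0 One_nat_def sum.shift_bounds_Suc_ivl ..
  also have "\<dots> \<le> (\<Sum>i=1..<stage_start (Suc k). loss i)" using assms by (intro sum_mono2) auto
  finally show ?thesis using total[of k] by simp
qed

lemma loss_sublinear: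
  fixes \<epsilon> :: real assumes "\<epsilon> > 0"
  shows "\<exists>C. \<forall>n. real (\<Sum>i<n. loss (Suc i)) \<le> \<epsilon> * n + C"
proof -
  have T_exp: "(3/2) ^ k \<le> real (stage_start k)" for k
  proof (induction k)
    case (Suc k)
    have "3/2 * real (stage_start k) \<le> real (stage_start k) + real (stage_start k div 2) + 5" by linarith
    then show ?case using Suc by (simp add: stage_start.simps)
  qed simp
  have "\<forall>\<^sub>F k in sequentially. 2 * (real k + 9)\<^sup>2 \<le> \<epsilon> * (3/2) ^ k"
    using assms by real_asymp
  then obtain N where N: "\<And>k. k \<ge> N \<Longrightarrow> 2 * (real k + 9)\<^sup>2 \<le> \<epsilon> * (3/2) ^ k"
    by (auto simp: eventually_sequentially)
  show ?thesis
  proof (intro exI allI)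
    fix n
    show "real (\<Sum>i<n. loss (Suc i)) \<le> \<epsilon> * n + 2 * (real N + 9)\<^sup>2"
    proof (cases "n < 2 \<or> stage n < N")
      case True
      have "n < stage_start (Suc N)"
      proof (cases "n < 2")
        case False
        then have "n < stage_start (Suc (stage n))" using stage[of n] by simp
        also have "\<dots> \<le> stage_start (Suc N)"
          using True False strict_mono_less_eq[OF strict_mono_stage_start, of "Suc (stage n)" "Suc N"] by linarith
        finally show ?thesis .
      qed (use stage_start_lower[of "Suc N"] in simp)
      then have "real (\<Sum>i<n. loss (Suc i)) \<le> real (2 * (N + 9)\<^sup>2)"
        unfolding of_nat_le_iff by (rule loss_sum)
      moreover have "0 \<le> \<epsilon> * n" using assms by simp
      ultimately show ?thesis by (simp add: add.commute)
    next
      case False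
      define k where "k = stage n"
      have k: "stage_start k \<le> n" "n < stage_start (Suc k)" "k \<ge> N" using stage[of n] False by (auto simp: k_def)
      have "real (\<Sum>i<n. loss (Suc i)) \<le> real (2 * (k + 9)\<^sup>2)"
        unfolding of_nat_le_iff by (rule loss_sum[OF k(2)])
      also have "\<dots> \<le> \<epsilon> * (3/2) ^ k" using N[OF k(3)] by (simp add: add.commute)
      also have "\<dots> \<le> \<epsilon> * n" using T_exp[of k] k(1) assms by (intro mult_left_mono) auto
      also have "\<dots> \<le> \<epsilon> * n + 2 * (real N + 9)\<^sup>2" by simp
      finally show ?thesis .
    qed
  qed
qed

section \<open>Realization of kneading sequences\<close>

lemma continuous_on_c1: "continuous_on A c1" and continuous_on_c2: "continuous_on A c2"
  unfolding c1_def c2_def by (auto intro!: continuous_intros)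

lemma continuous_on_F [continuous_intros]:
  assumes "continuous_on A f" "continuous_on A h" "\<And>x. x \<in> A \<Longrightarrow> f x \<in> params"
  shows "continuous_on A (\<lambda>x. F (f x) (h x))"
  unfolding F_def using assms by (intro continuous_intros) (force simp: params_def)+

lemma continuous_on_crit_value: "continuous_on params crit_value"
  unfolding crit_value_def by (intro continuous_intros continuous_on_c1) auto

text \<open>
  Inverse branches depend continuously on the parameter: the map \<open>(a, x) \<mapsto> (a, F a
  x)\<close> is injective and continuous on the compact set of all \<open>(a, x)\<close> with
  \<open>x\<close> in the branch, so its inverse is continuous.
\<close>

lemma continuous_inverse_branch:
  assumes l: "continuous_on params l" and u: "continuous_on params u"
    and lu: "\<And>a. a \<in> params \<Longrightarrow> l a \<le> u a"
    and inj: "\<And>a. a \<in> params \<Longrightarrow> inj_on (F a) {l a..u a}"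
    and h: "continuous_on params h" "\<And>a. a \<in> params \<Longrightarrow> h a \<in> F a ` {l a..u a}"
  shows "continuous_on params (\<lambda>a. the_inv_into {l a..u a} (F a) (h a))"
proof -
  define S where "S = (\<lambda>(a, s). (a, l a + s * (u a - l a))) ` (params \<times> {0..1})"
  have S: "p \<in> S \<longleftrightarrow> fst p \<in> params \<and> snd p \<in> {l (fst p)..u (fst p)}" for p
  proof
    assume "p \<in> S"
    then obtain q where q: "q \<in> params \<times> {0..1}" "p = (\<lambda>(a, s). (a, l a + s * (u a - l a))) q"
      unfolding S_def by blast
    obtain a s where "q = (a, s)" by fastforce
    with q have p: "p = (a, l a + s * (u a - l a))" "a \<in> params" "0 \<le> s" "s \<le> 1" by auto
    have "0 \<le> s * (u a - l a)" "s * (u a - l a) \<le> u a - l a"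
      using p lu[of a] by (auto intro: mult_left_le_one_le)
    then show "fst p \<in> params \<and> snd p \<in> {l (fst p)..u (fst p)}" using p by auto
  next
    assume p: "fst p \<in> params \<and> snd p \<in> {l (fst p)..u (fst p)}"
    obtain a x where ax: "p = (a, x)" by fastforce
    show "p \<in> S"
    proof (cases "l a = u a")
      case True
      then show ?thesis
        using p ax unfolding S_def by (intro image_eqI[of _ _ "(a, 0)"]) auto
    next
      case False
      then have "l a < u a" using p ax by auto
      then show ?thesis
        using p ax unfolding S_def
        by (intro image_eqI[of _ _ "(a, (x - l a) / (u a - l a))"]) auto
    qed
  qed
  define H where "H p = (fst p, F (fst p) (snd p))" for p
  have cont: "continuous_on (params \<times> {0..1}) (\<lambda>p. m (fst p))" if "continuous_on params m"
    for m :: "real \<Rightarrow> real"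
    by (rule continuous_on_compose2[OF that]) (auto intro!: continuous_intros)
  have "compact S"
    unfolding S_def case_prod_beta
    by (intro compact_continuous_image continuous_intros cont l u compact_Times)
       (auto simp: params_def)
  moreover have "continuous_on S H"
    unfolding H_def by (intro continuous_intros) (auto simp: S)
  moreover have "inj_on H S"
  proof (rule inj_onI)
    fix p q assume pq: "p \<in> S" "q \<in> S" "H p = H q"
    then have "fst p = fst q" "F (fst p) (snd p) = F (fst p) (snd q)" by (auto simp: H_def)
    then have "snd p = snd q" using pq S inj[of "fst p"] by (auto dest: inj_onD)
    with \<open>fst p = fst q\<close> show "p = q" by (simp add: prod_eq_iff)
  qed
  ultimately have g: "continuous_on (H ` S) (the_inv_into S H)" "inj_on H S"
    by (auto intro: continuous_on_inv_into)
  have eq: "(a, h a) \<in> H ` S \<and> snd (the_inv_into S H (a, h a)) = the_inv_into {l a..u a} (F a) (h a)"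
    if a: "a \<in> params" for a
  proof -
    obtain x where x: "x \<in> {l a..u a}" "h a = F a x" using h(2)[OF a] by auto
    then have "(a, x) \<in> S" "H (a, x) = (a, h a)" using a S by (auto simp: H_def)
    then show ?thesis
      using the_inv_into_f_f[OF g(2), of "(a, x)"] the_inv_into_f_f[OF inj[OF a], of x] x
      by (auto intro: rev_image_eqI)
  qed
  have "continuous_on params (\<lambda>a. snd (the_inv_into S H (a, h a)))"
    by (intro continuous_on_snd continuous_on_compose2[OF g(1)] continuous_intros h(1)) (use eq in auto)
  then show ?thesis using eq by (simp cong: continuous_on_cong)
qed

definition inv_left :: "real \<Rightarrow> real \<Rightarrow> real" where
  "inv_left a = the_inv_into {0..c1 a} (F a)"

definition inv_right :: "real \<Rightarrow> real \<Rightarrow> real" where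
  "inv_right a = the_inv_into {c2 a..1} (F a)"

lemma F_image:
  assumes "x \<le> y" "a \<in> params" "y' \<in> {F a x..F a y}" 
  shows "y' \<in> F a ` {x..y}"
proof -
  have "continuous_on {x..y} (F a)" using assms by (intro continuous_intros) auto
  then obtain z where "x \<le> z" "z \<le> y" "F a z = y'"
    using IVT'[of "F a" x y' y] assms by auto
  then show ?thesis by auto
qed

lemma inj_left: "a \<in> params \<Longrightarrow> inj_on (F a) {0..c1 a}"
  by (rule strict_mono_on_imp_inj_on[OF F_strict_mono_left])

lemma inj_right: "a \<in> params \<Longrightarrow> inj_on (F a) {c2 a..1}"
  by (rule strict_mono_on_imp_inj_on[OF F_strict_mono_right])

lemma inv_left:
  assumes a: "a \<in> params" and y: "y \<in> {0..crit_value a}"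
  shows "inv_left a y \<in> {0..c1 a}" "F a (inv_left a y) = y" "y \<in> F a ` {0..c1 a}"
proof -
  note inj = inj_left[OF a]
  show im: "y \<in> F a ` {0..c1 a}"
    using F_image[of 0 "c1 a" a y] crit_bounds[OF a] a y by (simp add: crit_value_def F_simps)
  show "inv_left a y \<in> {0..c1 a}" "F a (inv_left a y) = y"
    unfolding inv_left_def using the_inv_into_into[OF inj im order_refl] f_the_inv_into_f[OF inj im] by auto
qed

lemma inv_right:
  assumes a: "a \<in> params" and y: "y \<in> I01"
  shows "inv_right a y \<in> {c2 a..1}" "F a (inv_right a y) = y" "y \<in> F a ` {c2 a..1}"
proof -
  note inj = inj_right[OF a]
  show im: "y \<in> F a ` {c2 a..1}"
    using F_image[of "c2 a" 1 a y] crit_bounds[OF a] params_bounds[OF a] a y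
    by (simp add: F_c2 F_simps)
  show "inv_right a y \<in> {c2 a..1}" "F a (inv_right a y) = y"
    unfolding inv_right_def using the_inv_into_into[OF inj im order_refl] f_the_inv_into_f[OF inj im] by auto
qed

lemma F_left_le_iff: "a \<in> params \<Longrightarrow> x \<in> {0..c1 a} \<Longrightarrow> y \<in> {0..c1 a} \<Longrightarrow> F a x \<le> F a y \<longleftrightarrow> x \<le> y"
  using strict_mono_on_less_eq[OF F_strict_mono_left] by blast

lemma F_right_le_iff: "a \<in> params \<Longrightarrow> x \<in> {c2 a..1} \<Longrightarrow> y \<in> {c2 a..1} \<Longrightarrow> F a x \<le> F a y \<longleftrightarrow> x \<le> y"
  using strict_mono_on_less_eq[OF F_strict_mono_right] by blast

text \<open>
  The point reached from \<open>0\<close> by the inverse branches with symbols \<open>s i,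
  \<dots>, s (i + n - 1)\<close>. The left branch has range \<open>{0..crit_value a}\<close> only;
  truncating at \<open>crit_value a\<close> makes the point a continuous function of the parameter
  whether or not it has the prescribed itinerary.
\<close>

fun pull :: "(nat \<Rightarrow> bool) \<Rightarrow> real \<Rightarrow> nat \<Rightarrow> nat \<Rightarrow> real" where
  "pull s a 0 i = 0"
| "pull s a (Suc n) i = (if s i then inv_right a (pull s a n (Suc i))
     else inv_left a (min (pull s a n (Suc i)) (crit_value a)))"

lemma pull_range: "a \<in> params \<Longrightarrow> pull s a n i \<in> I01"
proof (induction n arbitrary: i)
  case (Suc n)
  have y: "pull s a n (Suc i) \<in> I01" using Suc by blast
  then have "min (pull s a n (Suc i)) (crit_value a) \<in> {0..crit_value a}" using crit_value_bounds[OF Suc.prems] by auto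
  then have "inv_left a (min (pull s a n (Suc i)) (crit_value a)) \<in> {0..c1 a}" by (rule inv_left[OF Suc.prems])
  moreover have "inv_right a (pull s a n (Suc i)) \<in> {c2 a..1}" by (rule inv_right[OF Suc.prems y])
  ultimately show ?case using crit_bounds[OF Suc.prems] by auto
qed simp

lemma pull_args:
  assumes "a \<in> params"
  shows "pull s a n i \<in> I01" "min (pull s a n i) (crit_value a) \<in> {0..crit_value a}"
  using pull_range[OF assms, of s n i] crit_value_bounds[OF assms] by auto

lemma continuous_pull: "continuous_on params (\<lambda>a. pull s a n i)"
proof (induction n arbitrary: i)
  case (Suc n)
  have L: "continuous_on params (\<lambda>a. inv_left a (min (pull s a n (Suc i)) (crit_value a)))"
    unfolding inv_left_def
  proof (rule continuous_inverse_branch)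
    show "continuous_on params (\<lambda>a. min (pull s a n (Suc i)) (crit_value a))"
      by (intro continuous_on_min Suc continuous_on_crit_value)
    fix a assume a: "a \<in> params"
    show "min (pull s a n (Suc i)) (crit_value a) \<in> F a ` {0..c1 a}"
      by (intro inv_left pull_args a)
    show "0 \<le> c1 a" using crit_bounds(3)[OF a] by simp
    show "inj_on (F a) {0..c1 a}" by (rule inj_left[OF a])
  qed (rule continuous_on_const continuous_on_c1)+
  have R: "continuous_on params (\<lambda>a. inv_right a (pull s a n (Suc i)))"
    unfolding inv_right_def
  proof (rule continuous_inverse_branch)
    fix a assume a: "a \<in> params"
    show "pull s a n (Suc i) \<in> F a ` {c2 a..1}"
      by (intro inv_right pull_args a)
    show "c2 a \<le> 1" using crit_bounds(6)[OF a] by simp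
    show "inj_on (F a) {c2 a..1}" by (rule inj_right[OF a])
  qed (rule continuous_on_const continuous_on_c2 Suc)+
  show ?case using L R by (cases "s i") auto
qed simp

lemma pull_mono:
  assumes a: "a \<in> params"
    and le: "pull s a m (Suc i) \<le> pull s a n (Suc j)" and s: "s i = s j"
  shows "pull s a (Suc m) i \<le> pull s a (Suc n) j"
proof (cases "s i")
  case True
  then show ?thesis
    using F_right_le_iff[OF a inv_right(1)[OF a pull_args(1)[OF a]] inv_right(1)[OF a pull_args(1)[OF a]]]
      le s by (simp add: inv_right(2)[OF a pull_args(1)[OF a]])
next
  case False
  have "min (pull s a m (Suc i)) (crit_value a) \<le> min (pull s a n (Suc j)) (crit_value a)" using le by auto
  then show ?thesis
    using F_left_le_iff[OF a inv_left(1)[OF a pull_args(2)[OF a]] inv_left(1)[OF a pull_args(2)[OF a]]]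
      False s by (simp add: inv_left(2)[OF a pull_args(2)[OF a]])
qed

lemma pull_incr:
  assumes "a \<in> params" "m \<le> n" shows "pull s a m i \<le> pull s a n i"
  using assms(2)
proof (induction m arbitrary: i n)
  case 0
  then show ?case using pull_range[OF assms(1), of s n i] by simp
next
  case (Suc m)
  then obtain n' where n: "n = Suc n'" "m \<le> n'" by (cases n) auto
  then show ?case using pull_mono[OF assms(1) Suc.IH] by blast
qed

lemma pull_lex:
  assumes a: "a \<in> params" and d: "\<forall>e<d. s (i + e) = s (j + e)" "\<not> s (i + d)" "s (j + d)"
  shows "pull s a n i \<le> pull s a n j"
  using d
proof (induction n arbitrary: i j d)
  case (Suc n)
  show ?case
  proof (cases d)
    case 0
    have "pull s a (Suc n) i \<le> c1 a" using Suc.prems 0 inv_left(1)[OF a pull_args(2)[OF a]] by simp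
    moreover have "c2 a \<le> pull s a (Suc n) j"
      using Suc.prems 0 inv_right(1)[OF a pull_args(1)[OF a]] by simp
    ultimately show ?thesis using crit_bounds[OF a] by linarith
  next
    case (Suc d')
    have "\<forall>e<d'. s (Suc i + e) = s (Suc j + e)" using Suc.prems(1) \<open>d = Suc d'\<close>
      by (metis Suc_less_eq add_Suc_shift)
    then have "pull s a n (Suc i) \<le> pull s a n (Suc j)"
      using Suc.IH[of d' "Suc i" "Suc j"] Suc.prems \<open>d = Suc d'\<close> by simp
    moreover have "s i = s j" using Suc.prems(1) \<open>d = Suc d'\<close> by (metis add_0_right zero_less_Suc)
    ultimately show ?thesis by (rule pull_mono[OF a])
  qed
qed simp

text \<open>
  The critical orbit is required to lie in the closed branch, so that this is a closed condition
  on the parameter.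
\<close>

definition follows :: "(nat \<Rightarrow> bool) \<Rightarrow> real \<Rightarrow> nat \<Rightarrow> bool" where
  "follows s a i \<longleftrightarrow> (if s i then c2 a \<le> (F a ^^ i) (crit_value a) else (F a ^^ i) (crit_value a) \<le> c1 a)"

context
  fixes s :: "nat \<Rightarrow> bool"
  assumes s01: "s 0" "\<not> s 1"
    and lex: "\<And>n. 1 \<le> n \<Longrightarrow> \<exists>d. (\<forall>i<d. s (n + i) = s i) \<and> \<not> s (n + d) \<and> s d"
begin

text \<open>
  If the critical value is the pulled-back point itself, no truncation takes place: tails of
  \<open>s\<close> are smaller than \<open>s\<close>, so the points pulled back along them are at
  most \<open>crit_value a\<close>.
\<close>

lemma orbit_of_fixed_pull:
  assumes a: "a \<in> params" and v: "crit_value a = pull s a n 0" and "i \<le> n"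
  shows "(F a ^^ i) (crit_value a) = pull s a (n - i) i"
  using assms(3)
proof (induction i)
  case (Suc i)
  obtain m where m: "n - i = Suc m" "n - Suc i = m" using Suc.prems by (metis Suc_diff_Suc Suc_le_lessD)
  obtain d where d: "\<forall>e<d. s (Suc i + e) = s (0 + e)" "\<not> s (Suc i + d)" "s (0 + d)"
    using lex[of "Suc i"] by auto
  have "pull s a m (Suc i) \<le> pull s a m 0" by (rule pull_lex[OF a d])
  also have "\<dots> \<le> crit_value a" unfolding v using m by (intro pull_incr[OF a]) auto
  finally have "min (pull s a m (Suc i)) (crit_value a) = pull s a m (Suc i)" by simp
  then have "F a (pull s a (Suc m) i) = pull s a m (Suc i)"
    using inv_left(2)[OF a pull_args(2)[OF a, of s m "Suc i"]]
      inv_right(2)[OF a pull_args(1)[OF a, of s m "Suc i"]] by auto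
  then show ?case using Suc m by simp
qed (simp add: v)

lemma pull_symbol:
  assumes "a \<in> params"
  shows "if s i then c2 a \<le> pull s a (Suc n) i else pull s a (Suc n) i \<le> c1 a"
  using inv_left(1)[OF assms pull_args(2)[OF assms, of s n "Suc i"]]
    inv_right(1)[OF assms pull_args(1)[OF assms, of s n "Suc i"]] by auto

text \<open>
  Intermediate value theorem for the difference of the critical value and the pulled-back point,
  which changes sign over the parameter range.
\<close>

lemma exists_param_finite: "\<exists>a\<in>params. \<forall>i<n. follows s a i"
proof -
  let ?N = "n + 2"
  have ends: "13/20 \<in> params" "67/100 \<in> params" by (auto simp: params_def)
  have "\<exists>a\<ge>13/20. a \<le> 67/100 \<and> crit_value a - pull s a ?N 0 = 0"
  proof (rule IVT')
    have "c2 (13/20) \<le> pull s (13/20) ?N 0"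
      using pull_symbol[OF ends(1), of 0 "Suc n"] s01 by simp
    then show "crit_value (13/20) - pull s (13/20) ?N 0 \<le> 0" using crit_value_left_end by linarith
    let ?a = "67/100 :: real"
    have "pull s ?a (Suc n) 1 \<le> c1 ?a" using pull_symbol[OF ends(2), of 1 n] s01 by simp
    also have "\<dots> \<le> F ?a (crit_value ?a)" by (rule crit_value_right_end)
    finally have "F ?a (pull s ?a ?N 0) \<le> F ?a (crit_value ?a)"
      using inv_right(2)[OF ends(2) pull_args(1)[OF ends(2), of s "Suc n" 1]] s01 by simp
    then have "pull s ?a ?N 0 \<le> crit_value ?a"
      using F_right_le_iff[OF ends(2), of "pull s ?a ?N 0" "crit_value ?a"] crit_value_right_end crit_value_bounds[OF ends(2)]
        pull_symbol[OF ends(2), of 0 "Suc n"] pull_range[OF ends(2), of s ?N 0] s01 by auto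
    then show "0 \<le> crit_value ?a - pull s ?a ?N 0" by simp
    show "continuous_on {13/20..67/100} (\<lambda>a. crit_value a - pull s a ?N 0)"
      using continuous_on_diff[OF continuous_on_crit_value continuous_pull, of s ?N 0]
      by (simp only: params_def)
  qed simp
  then obtain a where a: "a \<in> params" "crit_value a = pull s a ?N 0" by (auto simp: params_def)
  have "follows s a i" if i: "i < n" for i
  proof -
    obtain m where "?N - i = Suc m" using i by (metis Suc_diff_Suc trans_less_add1)
    then have orbit: "(F a ^^ i) (crit_value a) = pull s a (Suc m) i"
      using orbit_of_fixed_pull[OF a, of i] i by simp
    show ?thesis unfolding follows_def orbit by (rule pull_symbol[OF a(1)])
  qed
  then show ?thesis using a by blast
qed

lemma exists_param_itinerary: "\<exists>a\<in>params. \<forall>i. follows s a i"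
proof -
  define A where "A n = {a \<in> params. \<forall>i<n. follows s a i}" for n
  have orbit: "continuous_on params (\<lambda>a. (F a ^^ i) (crit_value a))" for i
    by (induction i) (auto intro!: continuous_intros continuous_on_crit_value)
  have "compact {a \<in> params. follows s a i}" for i
  proof -
    have "closed params" by (simp add: params_def)
    then have "closed {a \<in> params. follows s a i}"
      unfolding follows_def using orbit continuous_on_c1 continuous_on_c2
      by (cases "s i") (auto intro!: continuous_on_closed_Collect_le)
    moreover have "{a \<in> params. follows s a i} = params \<inter> {a \<in> params. follows s a i}" by auto
    ultimately show ?thesis by (metis compact_Int_closed compact_Icc params_def)
  qed
  then have "compact (A n)" for n
  proof (induction n)
    case 0
    have "A 0 = params" by (simp add: A_def)
    then show ?case by (simp add: params_def)
  next
    case (Suc n)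
    have "A (Suc n) = A n \<inter> {a \<in> params. follows s a n}"
      by (auto simp: A_def less_Suc_eq)
    then show ?case using Suc by (simp add: compact_Int)
  qed
  moreover have "A n \<noteq> {}" for n using exists_param_finite[of n] by (auto simp: A_def)
  ultimately have "\<Inter>(range A) \<noteq> {}"
    by (intro compact_nest) (auto simp: A_def)
  then obtain a where "\<And>n. a \<in> A n" by auto
  then show ?thesis by (intro bexI[of _ a]) (auto simp: A_def)
qed

end

section \<open>Derivatives along the critical orbit\<close>

definition DF :: "real \<Rightarrow> real \<Rightarrow> real" where "DF a x = (x\<^sup>2 - a) / (1 - a) * E a x"

definition DG :: "real \<Rightarrow> real \<Rightarrow> real" where
  "DG a y = ((y - a) / (1 - a)) ^ 3 * ((5 * y - a) / (1 - a))"

lemma abs_DF: "0 < x \<Longrightarrow> \<bar>DF a x\<bar> = sqrt (F a x / x) * \<bar>E a x\<bar>"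
  by (simp add: DF_def F_def abs_mult)

lemma abs_DG: "0 < x \<Longrightarrow> \<bar>DG a (x\<^sup>2)\<bar> = F a x / x * \<bar>DF a x\<bar>"
proof -
  assume "0 < x"
  define q where "q = (x\<^sup>2 - a) / (1 - a)"
  have "\<bar>q ^ 3\<bar> = q\<^sup>2 * \<bar>q\<bar>"
    by (simp add: abs_mult power3_eq_cube power2_eq_square)
  moreover have "DG a (x\<^sup>2) = q ^ 3 * E a x" "DF a x = q * E a x" "F a x / x = q\<^sup>2"
    using \<open>0 < x\<close> by (simp_all add: DF_def DG_def F_def E_def q_def)
  ultimately show ?thesis by (simp add: abs_mult)
qed

text \<open>
  Since \<open>F' = sqrt (F x / x) E\<close> up to sign, the first factors telescope. Here lies
  the difference between the two maps: the corresponding formula for \<open>G\<close> has an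
  additional factor \<open>F\<^sup>n x / x\<close> (\<open>abs_prod_DG\<close>), which is tiny
  when the orbit is close to \<open>0\<close>.
\<close>

lemma abs_prod_DF:
  assumes "\<And>i. i \<le> n \<Longrightarrow> 0 < (F a ^^ i) x"
  shows "\<bar>\<Prod>i<n. DF a ((F a ^^ i) x)\<bar> = sqrt ((F a ^^ n) x / x) * (\<Prod>i<n. \<bar>E a ((F a ^^ i) x)\<bar>)"
  using assms
proof (induction n)
  case 0
  then show ?case by simp
next
  case (Suc n)
  have p: "0 < (F a ^^ n) x" "0 < x" using Suc.prems[of n] Suc.prems[of 0] by auto
  have "sqrt ((F a ^^ n) x / x) * sqrt (F a ((F a ^^ n) x) / (F a ^^ n) x)
      = sqrt (F a ((F a ^^ n) x) / x)"
    using p by (simp flip: real_sqrt_mult)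
  then show ?case using Suc abs_DF[OF p(1), of a] by (simp add: abs_mult algebra_simps)
qed

lemma abs_prod_DG:
  assumes "\<And>i. i \<le> n \<Longrightarrow> 0 < (F a ^^ i) x"
  shows "\<bar>\<Prod>i<n. DG a (((F a ^^ i) x)\<^sup>2)\<bar> = (F a ^^ n) x / x * \<bar>\<Prod>i<n. DF a ((F a ^^ i) x)\<bar>"
  using assms
proof (induction n)
  case 0
  then show ?case by simp
next
  case (Suc n)
  have p: "0 < (F a ^^ n) x" "0 < x" using Suc.prems[of n] Suc.prems[of 0] by auto
  have IH: "\<bar>\<Prod>i<n. DG a (((F a ^^ i) x)\<^sup>2)\<bar> = (F a ^^ n) x / x * \<bar>\<Prod>i<n. DF a ((F a ^^ i) x)\<bar>"
    using Suc by simp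
  show ?case
    unfolding prod.lessThan_Suc abs_mult IH abs_DG[OF p(1)] using p by simp
qed

lemma G_funpow: "(G a ^^ n) (x\<^sup>2) = ((F a ^^ n) x)\<^sup>2"
  by (induction n) (simp_all add: G_square)

lemma F_funpow_lipschitz:
  assumes a: "a \<in> params" and "x \<in> I01" "y \<in> I01"
  shows "\<bar>(F a ^^ n) x - (F a ^^ n) y\<bar> \<le> 32 ^ n * \<bar>x - y\<bar>"
    "(F a ^^ n) x \<in> I01"
proof -
  have I: "(F a ^^ n) z \<in> I01" if "z \<in> I01" for z n
    using that F_I01[OF a] by (induction n) auto
  show "(F a ^^ n) x \<in> I01" using I assms by blast
  show "\<bar>(F a ^^ n) x - (F a ^^ n) y\<bar> \<le> 32 ^ n * \<bar>x - y\<bar>"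
  proof (induction n)
    case (Suc n)
    then show ?case
      using F_lipschitz[OF a I[OF assms(2)] I[OF assms(3)], of n n] by simp
  qed simp
qed

context
  fixes a :: real
  assumes a: "a \<in> params" and follows: "\<And>i. follows kneading a i"
begin

definition orb :: "nat \<Rightarrow> real" where "orb i = (F a ^^ i) (crit_value a)"

definition total_loss :: "nat \<Rightarrow> nat" where "total_loss n = (\<Sum>i<n. loss (Suc i))"

lemma orb_0: "orb 0 = crit_value a" and orb_Suc: "orb (Suc i) = F a (orb i)"
  by (simp_all add: orb_def)

lemma orb_range: "orb i \<in> I01"
  unfolding orb_def using crit_value_bounds[OF a] by (intro F_funpow_lipschitz(2)[OF a, of _ 0]) auto

lemma orb_symbol: "kneading i \<Longrightarrow> c2 a \<le> orb i" "\<not> kneading i \<Longrightarrow> orb i \<le> c1 a"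
  using follows[of i] by (auto simp: follows_def orb_def)

text \<open>
  The orbit is away from \<open>0\<close> at the start of the next stage, and distances to
  \<open>0\<close> grow at most by the factor \<open>33/8\<close> in each step; so at any time it
  is not closer to \<open>0\<close> than the remaining length of the stage allows.
\<close>

lemma orb_lower:
  assumes "n \<le> stage_start k" shows "4/5 * (8/33) ^ (stage_start k - n) \<le> orb n"
proof -
  have "orb (n + m) \<le> (33/8) ^ m * orb n" for m
  proof (induction m)
    case (Suc m)
    have "orb (n + Suc m) \<le> 33/8 * orb (n + m)"
      using F_le[OF a orb_range[of "n + m"]] by (simp add: orb_Suc)
    then show ?case using Suc by simp
  qed simp
  from this[of "stage_start k - n"] have "orb (stage_start k) \<le> (33/8) ^ (stage_start k - n) * orb n" using assms by simp
  moreover have "4/5 \<le> orb (stage_start k)"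
    using orb_symbol(1)[OF kneading_stage_start, of k] crit_bounds(5)[OF a] by linarith
  ultimately have "4/5 \<le> (33/8) ^ (stage_start k - n) * orb n" by linarith
  moreover have "(8/33 :: real) ^ m = 1 / (33/8) ^ m" for m
    by (simp add: power_divide)
  ultimately show ?thesis by (simp add: pos_divide_le_eq mult.commute)
qed

lemma orb_pos: "0 < orb n"
proof -
  have "n \<le> stage_start n" using stage_start_lower[of n] by simp
  from orb_lower[OF this] show ?thesis
    by (rule less_le_trans[rotated]) simp
qed

lemma orb_deep: "loss (Suc i) = 0 \<Longrightarrow> orb i \<le> 1/8"
  using loss_eq_0[of i] orb_symbol(2)[of i] orb_symbol(2)[of "Suc i"] orb_range[of i]
  by (intro deep_left[OF a]) (auto simp: orb_Suc)

text \<open>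
  The tail of the kneading sequence at \<open>Suc i\<close> differs from \<open>kneading\<close>
  after at most \<open>copy_len\<close> steps. At that time the orbits of \<open>orb (Suc
  i)\<close> and of the critical value are in different branches, so by the Lipschitz bound they
  cannot have been too close at the beginning.
\<close>

lemma critical_distance:
  assumes "\<not> kneading i"
  shows "2/5 * (1/32) ^ (copy_len (stage (Suc i)) + 1) \<le> c1 a - orb i"
proof -
  let ?p = "copy_len (stage (Suc i))"
  obtain d where d: "d \<le> ?p" "falls_below (Suc i) d" using tails_fall_below[of "Suc i"] by auto
  have c: "c1 a \<in> I01" "orb i \<in> I01" "crit_value a \<in> I01" "orb (Suc i) \<in> I01"
    using crit_bounds[OF a] orb_range crit_value_bounds[OF a] by auto
  have "2/5 \<le> c2 a - c1 a" using crit_bounds[OF a] by linarith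
  also have "\<dots> \<le> \<bar>orb (d + Suc i) - orb d\<bar>"
    using orb_symbol(2)[of "Suc i + d"] orb_symbol(1)[of d] d(2)
    by (simp add: falls_below_def add.commute)
  also have "\<dots> \<le> 32 ^ d * \<bar>orb (Suc i) - crit_value a\<bar>"
    using F_funpow_lipschitz(1)[OF a c(4) c(3), of d] 
    unfolding orb_def funpow_add by simp
  also have "\<dots> \<le> 32 ^ d * (32 * (c1 a - orb i))"
    using F_lipschitz[OF a c(2) c(1)] orb_symbol(2)[OF assms]
    by (intro mult_left_mono) (auto simp: orb_Suc crit_value_def)
  also have "\<dots> = 32 ^ (d + 1) * (c1 a - orb i)" by simp
  also have "\<dots> \<le> 32 ^ (?p + 1) * (c1 a - orb i)"
    using d(1) orb_symbol(2)[OF assms] by (intro mult_right_mono power_increasing) auto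
  finally have "2/5 / 32 ^ (?p + 1) \<le> c1 a - orb i" by (subst pos_divide_le_eq) (auto simp: mult.commute)
  then show ?thesis by (simp only: power_one_over mult_1_right times_divide_eq_right)
qed

lemma expansion_step:
  assumes z: "0 \<le> z" "z \<le> orb i" "kneading i \<Longrightarrow> c2 a \<le> z"
  shows "8/5 * (1/32) ^ loss (Suc i) \<le> \<bar>E a z\<bar>"
proof (cases "loss (Suc i) = 0")
  case True
  then have "z \<le> 1/8" using orb_deep[of i] z by simp
  then show ?thesis using abs_E_deep[OF a z(1)] True by simp
next
  case False
  let ?p = "copy_len (stage (Suc i))"
  have l: "loss (Suc i) = ?p + 2" using False by (simp add: loss_def split: if_splits)
  show ?thesis
  proof (cases "kneading i")
    case True
    have "(1/32 :: real) ^ (?p + 2) \<le> (1/32) ^ 1" by (intro power_decreasing) auto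
    moreover have "1 \<le> \<bar>E a z\<bar>" using abs_E_right_ge[OF a] z True by blast
    ultimately show ?thesis unfolding l power_one_right by argo
  next
    case kneading: False
    have "8/5 * (1/32) ^ (?p + 2) \<le> 2/5 * (1/32 :: real) ^ (?p + 1)" by simp
    also have "\<dots> \<le> c1 a - orb i" by (rule critical_distance[OF kneading])
    also have "\<dots> \<le> \<bar>E a z\<bar>" using abs_E_left_ge[OF a z(1,2)] orb_symbol(2)[OF kneading] .
    finally show ?thesis unfolding l .
  qed
qed

text \<open>
  The bound is for all points \<open>z\<close> that have the itinerary of the critical value and
  whose orbit stays to the left of the critical orbit, not only for the critical value: this is
  used again for recurrence.
\<close>

lemma expansion:
  assumes "\<And>i. i < n \<Longrightarrow> 0 \<le> z i" "\<And>i. i < n \<Longrightarrow> z i \<le> orb i"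
    and "\<And>i. i < n \<Longrightarrow> kneading i \<Longrightarrow> c2 a \<le> z i"
  shows "(8/5) ^ n * (1/32) ^ total_loss n \<le> (\<Prod>i<n. \<bar>E a (z i)\<bar>)"
proof -
  have "(8/5) ^ n * (1/32) ^ total_loss n = (\<Prod>i<n. 8/5 * (1/32 :: real) ^ loss (Suc i))"
    unfolding total_loss_def by (simp only: prod.distrib power_sum prod_constant card_lessThan)
  also have "\<dots> \<le> (\<Prod>i<n. \<bar>E a (z i)\<bar>)"
    using assms expansion_step by (intro prod_mono) auto
  finally show ?thesis .
qed

lemma expansion_upper: "(\<Prod>i<n. \<bar>E a (orb i)\<bar>) \<le> (67/33) ^ n * 14 ^ total_loss n"
proof -
  have "\<bar>E a (orb i)\<bar> \<le> 67/33 * 14 ^ loss (Suc i)" for i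
  proof (cases "loss (Suc i) = 0")
    case True
    then show ?thesis
      using abs_E_left_le[OF a, of "orb i"] orb_symbol(2)[of i] loss_eq_0[of i] orb_range[of i] by auto
  next
    case False
    then have "(14 :: real) ^ 1 \<le> 14 ^ loss (Suc i)" by (intro power_increasing) auto
    then show ?thesis using abs_E_le[OF a orb_range[of i]] by simp
  qed
  then have "(\<Prod>i<n. \<bar>E a (orb i)\<bar>) \<le> (\<Prod>i<n. 67/33 * 14 ^ loss (Suc i))"
    by (intro prod_mono) auto
  also have "\<dots> = (67/33) ^ n * 14 ^ total_loss n"
    unfolding total_loss_def by (simp only: prod.distrib power_sum prod_constant card_lessThan)
  finally show ?thesis .
qed

lemma total_loss_sublinear:
  fixes \<epsilon> :: real assumes "\<epsilon> > 0"
  obtains C where "\<And>n. total_loss n \<le> \<epsilon> * n + C"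
  using loss_sublinear[OF assms] unfolding total_loss_def by blast

lemma has_DF: "(F a has_real_derivative DF a x) (at x)"
  unfolding DF_def using DERIV_F params_bounds[OF a] by simp

lemma F_image_I01: "F a ` I01 \<subseteq> I01" using F_I01[OF a] by blast

lemma abs_deriv_F:
  "\<bar>nderiv 1 (F a ^^ n) (crit_value a)\<bar> = sqrt (orb n / crit_value a) * (\<Prod>i<n. \<bar>E a (orb i)\<bar>)"
proof -
  have "nderiv 1 (F a ^^ n) (crit_value a) = (\<Prod>i<n. DF a ((F a ^^ i) (crit_value a)))"
    using crit_value_bounds[OF a] by (intro nderiv_funpow has_DF F_image_I01) auto
  then show ?thesis
    using abs_prod_DF[of n a "crit_value a"] orb_pos unfolding orb_def by simp
qed

lemma abs_deriv_G:
  "\<bar>nderiv 1 (G a ^^ n) ((crit_value a)\<^sup>2)\<bar> = orb n / crit_value a * \<bar>nderiv 1 (F a ^^ n) (crit_value a)\<bar>"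
proof -
  have dG: "(G a has_real_derivative DG a y) (at y)" for y
    unfolding DG_def using DERIV_G params_bounds[OF a] by simp
  have G: "G a ` I01 \<subseteq> I01" using G_I01[OF a] by blast
  have "nderiv 1 (G a ^^ n) ((crit_value a)\<^sup>2) = (\<Prod>i<n. DG a ((G a ^^ i) ((crit_value a)\<^sup>2)))"
    using crit_value_bounds[OF a] by (intro nderiv_funpow dG G) (auto simp: power_le_one)
  moreover have "nderiv 1 (F a ^^ n) (crit_value a) = (\<Prod>i<n. DF a ((F a ^^ i) (crit_value a)))"
    using crit_value_bounds[OF a] by (intro nderiv_funpow has_DF F_image_I01) auto
  ultimately show ?thesis
    using abs_prod_DG[of n a "crit_value a"] orb_pos unfolding orb_def G_funpow by simp
qed

text \<open>
  At time \<open>n\<close> the remaining run has length at most about \<open>n / 2\<close>, hence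
  \<open>sqrt (orb n)\<close> is at least about \<open>(33/8)^(- n / 4)\<close>, while the factors
  \<open>E\<close> contribute \<open>(8/5)^n\<close> up to a subexponential loss. The product
  grows exponentially because \<open>(8/5)^4 > 33/8\<close>.
\<close>

lemma Collet_Eckmann_F: "Collet_Eckmann (F a) (c1 a)"
proof -
  define \<beta> where "\<beta> = ln (8/5 :: real) - ln (33/8) / 4"
  have "4 * ln (8/5 :: real) = ln ((8/5) ^ 4)" by (subst ln_realpow) auto
  moreover have "ln (33/8 :: real) < ln ((8/5) ^ 4)" by (subst ln_less_cancel_iff) (auto simp: power_divide)
  ultimately have \<beta>: "\<beta> > 0" unfolding \<beta>_def by linarith
  have l32: "ln (32 :: real) > 0" by simp
  obtain C where C: "\<And>n. total_loss n \<le> \<beta> / (2 * ln 32) * n + C"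
    using total_loss_sublinear[of "\<beta> / (2 * ln 32)"] \<beta> l32 by auto
  define D where "D = ln (4/5) / 2 - 5/2 * ln (33/8 :: real) - C * ln 32"
  have "exp D * exp (\<beta> / 2) ^ n \<le> \<bar>nderiv 1 (F a ^^ n) (crit_value a)\<bar>" for n
  proof -
    obtain k where k: "n \<le> stage_start k" "real (stage_start k - n) \<le> n / 2 + 5"
    proof (cases "n < 2")
      case True
      then show ?thesis by (intro that[of 0]) auto
    next
      case False
      then have s: "stage_start (stage n) \<le> n" "n < stage_start (Suc (stage n))" using stage[of n] by auto
      have "real (stage_start (Suc (stage n))) \<le> n + n / 2 + 5"
        using s(1) unfolding stage_start.simps(2) by linarith
      then show ?thesis using s by (intro that[of "Suc (stage n)"]) auto
    qed
    define m where "m = stage_start k - n"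
    define B where "B = sqrt (4/5 * (8/33) ^ m) * ((8/5) ^ n * (1/32) ^ total_loss n)"
    have B: "B > 0" by (simp add: B_def)
    have ln833: "ln (8/33 :: real) = - ln (33/8)" "ln (1/32 :: real) = - ln 32"
      by (simp_all add: ln_div)
    have "ln B = (ln (4/5) - m * ln (33/8)) / 2 + n * ln (8/5) - total_loss n * ln 32"
    proof -
      have "ln B = ln (4/5 * (8/33) ^ m) / 2 + (ln ((8/5) ^ n) + ln ((1/32) ^ total_loss n))"
        unfolding B_def by (subst ln_mult; simp add: ln_sqrt ln_mult)
      also have "ln (4/5 * (8/33 :: real) ^ m) = ln (4/5) + m * ln (8/33)"
        by (subst ln_mult; simp add: ln_realpow)
      finally show ?thesis
        unfolding ln833 using ln_realpow[of "8/5" n] ln_realpow[of "1/32" "total_loss n"]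
        by (simp add: ln833)
    qed
    moreover have "m * ln (33/8 :: real) \<le> n * ln (33/8) / 2 + 5 * ln (33/8)"
      using mult_right_mono[OF k(2), of "ln (33/8)"] by (simp add: m_def algebra_simps)
    moreover have "total_loss n * ln (32 :: real) \<le> n * \<beta> / 2 + C * ln 32"
    proof -
      have "total_loss n * ln (32 :: real) \<le> (\<beta> / (2 * ln 32) * n + C) * ln 32"
        using C[of n] l32 by (intro mult_right_mono) auto
      also have "\<dots> = n * \<beta> / 2 + C * ln (32 :: real)"
        using l32 by (simp add: field_simps)
      finally show ?thesis .
    qed
    moreover have "n * \<beta> = n * ln (8/5) - n * ln (33/8) / 4"
      by (simp add: \<beta>_def algebra_simps)
    ultimately have "D + n * \<beta> / 2 \<le> ln B"
      unfolding D_def by argo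
    then have "D + \<beta> / 2 * n \<le> ln B" by (simp add: mult.commute)
    then have "exp (D + \<beta> / 2 * n) \<le> B" using B by (simp add: ln_ge_iff)
    also have "exp (D + \<beta> / 2 * n) = exp D * exp (\<beta> / 2) ^ n"
      by (simp add: exp_add mult.commute flip: exp_of_nat_mult)
    also have "B \<le> sqrt (orb n / crit_value a) * (\<Prod>i<n. \<bar>E a (orb i)\<bar>)"
      unfolding B_def
    proof (intro mult_mono)
      have "4/5 * (8/33) ^ m \<le> orb n" unfolding m_def by (rule orb_lower[OF k(1)])
      also have "\<dots> \<le> orb n / crit_value a"
        using crit_value_bounds[OF a] orb_pos[of n] by (simp add: pos_le_divide_eq mult_left_le)
      finally show "sqrt (4/5 * (8/33) ^ m) \<le> sqrt (orb n / crit_value a)" by simp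
      show "(8/5) ^ n * (1/32) ^ total_loss n \<le> (\<Prod>i<n. \<bar>E a (orb i)\<bar>)"
        using orb_pos orb_symbol by (intro expansion) (auto intro: less_imp_le)
      show "0 \<le> sqrt (orb n / crit_value a)" using crit_value_bounds[OF a] orb_pos[of n] by simp
    qed simp
    finally show ?thesis unfolding abs_deriv_F .
  qed
  moreover have "exp D / 2 * exp (\<beta> / 2) ^ n < exp D * exp (\<beta> / 2) ^ n" for n by simp
  ultimately have "\<forall>n. exp D / 2 * exp (\<beta> / 2) ^ n < \<bar>nderiv 1 (F a ^^ n) (crit_value a)\<bar>"
    using less_le_trans by blast
  moreover have "exp (\<beta> / 2) > 1" using \<beta> by simp
  moreover have "exp D / 2 > 0" by simp
  ultimately show ?thesis unfolding Collet_Eckmann_def crit_value_def by blast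
qed

text \<open>
  At the beginning of the run of L in stage \<open>k\<close> the orbit is exponentially close to
  \<open>0\<close>, as it moves away from \<open>0\<close> at least by the factor
  \<open>13/4\<close> in each step of the run.
\<close>

lemma orb_upper:
  assumes n: "n = stage_start k + copy_len k"
  shows "orb n \<le> (4/13) ^ (stage_start (Suc k) - 1 - n)"
proof -
  define p where "p = copy_len k"
  have gap: "n < stage_start (Suc k)" using copy_len_gap[of k] copy_len_ge_2[of k] unfolding n by linarith
  have "(13/4) ^ m * orb n \<le> orb (n + m)" if "n + m < stage_start (Suc k)" for m
    using that
  proof (induction m)
    case (Suc m)
    have "\<not> kneading (n + m)" "\<not> kneading (Suc (n + m))"
      using kneading_run[of k "p + m"] kneading_run[of k "Suc (p + m)"] Suc.prems unfolding n p_def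
      by (auto simp: add.assoc)
    then have "orb (n + m) \<le> 1/8"
      using orb_symbol(2)[of "n + m"] orb_symbol(2)[of "Suc (n + m)"] orb_range[of "n + m"]
      by (intro deep_left[OF a]) (auto simp: orb_Suc)
    then have "13/4 * orb (n + m) \<le> orb (n + Suc m)"
      using F_ge[OF a, of "orb (n + m)"] orb_pos[of "n + m"] by (simp add: orb_Suc)
    then show ?case using Suc by simp
  qed simp
  from this[of "stage_start (Suc k) - 1 - n"] have "(13/4) ^ (stage_start (Suc k) - 1 - n) * orb n \<le> 1"
    using gap orb_range[of "stage_start (Suc k) - 1"] by simp
  moreover have "(4/13 :: real) ^ m = 1 / (13/4) ^ m" for m by (simp add: power_divide)
  ultimately show ?thesis by (simp add: pos_le_divide_eq mult.commute)
qed

text \<open>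
  At the beginning \<open>n\<close> of a run, whose length is about \<open>n / 2\<close>, the
  derivative is at most about \<open>(67/33)^n (13/4)^(- 3 n / 4)\<close>, which tends to
  \<open>0\<close> because \<open>(67/33)^4 < (13/4)^3\<close>.
\<close>

lemma not_Collet_Eckmann_G: "\<not> Collet_Eckmann (G a) ((c1 a)\<^sup>2)"
proof
  assume "Collet_Eckmann (G a) ((c1 a)\<^sup>2)"
  moreover have "G a ((c1 a)\<^sup>2) = (crit_value a)\<^sup>2" by (simp add: G_square crit_value_def)
  ultimately obtain c \<Lambda> where c: "c > 0" "\<Lambda> > 1"
    "\<And>n. c * \<Lambda> ^ n < \<bar>nderiv 1 (G a ^^ n) ((crit_value a)\<^sup>2)\<bar>"
    unfolding Collet_Eckmann_def by auto
  have lower: "c \<le> \<bar>nderiv 1 (G a ^^ n) ((crit_value a)\<^sup>2)\<bar>" for n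
  proof -
    have "c * 1 \<le> c * \<Lambda> ^ n" using c by (intro mult_left_mono) auto
    then show ?thesis using c(3)[of n] by linarith
  qed
  define \<gamma> where "\<gamma> = 3/4 * ln (13/4 :: real) - ln (67/33)"
  have "3 * ln (13/4 :: real) = ln ((13/4) ^ 3)" "4 * ln (67/33 :: real) = ln ((67/33) ^ 4)"
    by (subst ln_realpow; simp)+
  moreover have "ln ((67/33) ^ 4) < ln ((13/4 :: real) ^ 3)"
    by (subst ln_less_cancel_iff) (auto simp: power_divide)
  ultimately have \<gamma>: "\<gamma> > 0" unfolding \<gamma>_def by linarith
  define \<mu> where "\<mu> = ln 14 + 9/4 * ln (13/4 :: real)"
  have \<mu>: "\<mu> > 0" unfolding \<mu>_def by (intro add_pos_pos mult_pos_pos) auto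
  obtain C where C: "\<And>n. total_loss n \<le> \<gamma> / (2 * \<mu>) * n + C"
    using total_loss_sublinear[of "\<gamma> / (2 * \<mu>)"] \<gamma> \<mu> by auto
  define v0 where "v0 = - 3/2 * ln (crit_value a)"
  \<comment> \<open>The index \<open>k\<close> is unbounded and the right-hand side tends to minus infinity.\<close>
  have key: "ln c \<le> v0 + C * \<mu> - \<gamma> / 2 * real k" for k
  proof -
    define p n m :: nat where "p = copy_len k" and "n = stage_start k + p" and "m = stage_start (Suc k) - 1 - n"
    have gap: "n < stage_start (Suc k)" using copy_len_gap[of k] copy_len_ge_2[of k] unfolding n_def p_def by linarith
    have "loss (stage_start k) = p + 2"
      using stage_eq[of k "stage_start k"] gap unfolding loss_def n_def p_def by simp
    moreover have "loss (stage_start k) \<le> total_loss n"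
    proof -
      have "loss (Suc (stage_start k - 1)) \<le> total_loss n"
        unfolding total_loss_def using copy_len_ge_2[of k] stage_start_lower[of k]
        by (intro member_le_sum) (auto simp: n_def p_def)
      then show ?thesis using stage_start_lower[of k] by simp
    qed
    ultimately have p: "p \<le> total_loss n" by simp
    have "real n / 2 - 3/2 * real p \<le> m"
    proof -
      have "stage_start k div 2 + 2 \<le> m + p" unfolding m_def n_def stage_start.simps by linarith
      then have "real (stage_start k div 2) + 2 \<le> real m + real p" by linarith
      moreover have "real (stage_start k) \<le> 2 * real (stage_start k div 2) + 1" by linarith
      ultimately show ?thesis unfolding n_def of_nat_add by argo
    qed
    then have m: "real n / 2 - 3/2 * real (total_loss n) \<le> m" using p by linarith
    have pos: "0 < orb n" "0 < crit_value a" using orb_pos crit_value_bounds[OF a] by auto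
    have "c \<le> orb n / crit_value a * (sqrt (orb n / crit_value a) * (\<Prod>i<n. \<bar>E a (orb i)\<bar>))"
      using lower[of n] unfolding abs_deriv_G abs_deriv_F .
    also have "\<dots> \<le> orb n / crit_value a * (sqrt (orb n / crit_value a) * ((67/33) ^ n * 14 ^ total_loss n))"
      using pos by (intro mult_left_mono expansion_upper) auto
    finally have "ln c \<le> ln (orb n / crit_value a * (sqrt (orb n / crit_value a) * ((67/33) ^ n * 14 ^ total_loss n)))"
      using c(1) by (subst ln_le_cancel_iff) (use pos in auto)
    also have "\<dots> = 3/2 * ln (orb n) + v0 + n * ln (67/33) + total_loss n * ln 14"
      using pos by (simp add: ln_mult ln_div ln_sqrt ln_realpow v0_def field_simps)
    finally have 1: "ln c \<le> 3/2 * ln (orb n) + v0 + n * ln (67/33) + total_loss n * ln 14" .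
    have "ln (orb n) \<le> ln ((4/13) ^ m)"
      using orb_upper[of n k] pos unfolding m_def n_def p_def by (subst ln_le_cancel_iff) auto
    also have "\<dots> = - (m * ln (13/4))" by (subst ln_realpow) (auto simp: ln_div algebra_simps)
    also have "\<dots> \<le> - ((real n / 2 - 3/2 * real (total_loss n)) * ln (13/4))"
      using m by (intro le_imp_neg_le mult_right_mono) auto
    finally have 2: "ln (orb n) \<le> - ((real n / 2 - 3/2 * real (total_loss n)) * ln (13/4))" .
    have "ln c \<le> v0 + total_loss n * \<mu> - \<gamma> * n"
      using 1 2 unfolding \<mu>_def \<gamma>_def by (simp add: algebra_simps)
    moreover have "total_loss n * \<mu> \<le> (\<gamma> / (2 * \<mu>) * n + C) * \<mu>"
      using C[of n] \<mu> by (intro mult_right_mono) auto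
    moreover have "(\<gamma> / (2 * \<mu>) * n + C) * \<mu> = \<gamma> / 2 * n + C * \<mu>"
      using \<mu> by (simp add: field_simps)
    moreover have "\<gamma> / 2 * k \<le> \<gamma> / 2 * n"
      using \<gamma> stage_start_lower[of k] by (intro mult_left_mono) (auto simp: n_def)
    ultimately show ?thesis by linarith
  qed
  obtain k :: nat where "2 / \<gamma> * (v0 + C * \<mu> - ln c) < k" using reals_Archimedean2 by blast
  then have "v0 + C * \<mu> - ln c < \<gamma> / 2 * k" using \<gamma> by (simp add: field_simps)
  then show False using key[of k] by linarith
qed

section \<open>Recurrence of the critical point\<close>

text \<open>
  At time \<open>stage_start k\<close> the critical orbit has the same itinerary as the critical
  value for \<open>copy_len k\<close> steps. If it stayed below some \<open>u < crit_value
  a\<close> for arbitrarily long copies, the interval from \<open>u\<close> to \<open>crit_value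
  a\<close> would be mapped monotonically by all iterates, with orbits to the left of the critical
  orbit; by \<open>expansion\<close> its images would become arbitrarily long.
\<close>

lemma returns_close:
  assumes u: "u < crit_value a"
  shows "\<exists>j0. \<forall>k. j0 < copy_len k \<longrightarrow> u < orb (stage_start k)"
proof (rule ccontr)
  assume "\<not> ?thesis"
  then have often: "\<exists>k. j < copy_len k \<and> orb (stage_start k) \<le> u" for j by (meson not_le)
  \<comment> \<open>Orbits starting between \<open>u\<close> and the critical value are sandwiched between two orbits
    that have the same symbols.\<close>
  have same: "(y' \<le> orb j) \<and> (kneading j \<longrightarrow> c2 a \<le> y') \<and> 0 < y'"
    if y: "u \<le> y" "y \<le> crit_value a" and y': "y' = (F a ^^ j) y" for y y' j
  proof -
    obtain k where k: "j < copy_len k" "orb (stage_start k) \<le> u" using often by blast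
    have between: "orb (stage_start k + i) \<le> (F a ^^ i) y \<and> (F a ^^ i) y \<le> orb i" if "i \<le> j" for i
      using that
    proof (induction i)
      case 0
      then show ?case using y k by (simp add: orb_0)
    next
      case (Suc i)
      then have IH: "orb (stage_start k + i) \<le> (F a ^^ i) y" "(F a ^^ i) y \<le> orb i" by auto
      have kneading: "kneading (stage_start k + i) = kneading i" using kneading_copy k Suc.prems by simp
      have mono: "F a p \<le> F a q" if "p \<le> q" "orb (stage_start k + i) \<le> p" "q \<le> orb i" for p q
      proof (cases "kneading i")
        case True
        then show ?thesis
          using F_right_le_iff[OF a, of p q] that orb_symbol(1)[of "stage_start k + i"] kneading orb_range[of i] by auto
      next
        case False
        then show ?thesis
          using F_left_le_iff[OF a, of p q] that orb_symbol(2)[of i] orb_range[of "stage_start k + i"] by auto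
      qed
      show ?case using mono IH by (simp add: orb_Suc)
    qed
    have "kneading (stage_start k + j) = kneading j" using kneading_copy k by simp
    then show ?thesis
      using between[of j] orb_symbol(1)[of "stage_start k + j"] orb_pos[of "stage_start k + j"] y' by auto
  qed
  have u0: "0 < u" using same[of u u 0] u by simp
  \<comment> \<open>Mean value theorem on the interval, whose image has length at most \<open>1\<close>.\<close>
  have bound: "(8/5) ^ n * (1/32) ^ total_loss n * (4/5 * (crit_value a - u)) \<le> 1" if n: "kneading n" for n
  proof -
    have der: "((F a ^^ n) has_real_derivative (\<Prod>i<n. DF a ((F a ^^ i) y))) (at y)"
      if "u \<le> y" "y \<le> crit_value a" for y
      using that u0 crit_value_bounds[OF a] by (intro DERIV_funpow has_DF F_image_I01) auto
    obtain y where y: "u < y" "y < crit_value a"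
      "(F a ^^ n) (crit_value a) - (F a ^^ n) u = (crit_value a - u) * (\<Prod>i<n. DF a ((F a ^^ i) y))"
      using MVT2[OF u der] by auto
    note y_orb = same[OF less_imp_le[OF y(1)] less_imp_le[OF y(2)] refl]
    have "4/5 * ((8/5) ^ n * (1/32) ^ total_loss n)
        \<le> sqrt ((F a ^^ n) y / y) * (\<Prod>i<n. \<bar>E a ((F a ^^ i) y)\<bar>)"
    proof (intro mult_mono)
      have "(4/5)\<^sup>2 \<le> c2 a" using crit_bounds(5)[OF a] by (simp add: power2_eq_square)
      also have "\<dots> \<le> (F a ^^ n) y" using y_orb n by blast
      also have "\<dots> \<le> (F a ^^ n) y / y"
        using y u0 crit_value_bounds[OF a] y_orb[of n] by (simp add: pos_le_divide_eq mult_left_le)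
      finally show "4/5 \<le> sqrt ((F a ^^ n) y / y)" by (rule real_le_rsqrt)
      show "(8/5) ^ n * (1/32) ^ total_loss n \<le> (\<Prod>i<n. \<bar>E a ((F a ^^ i) y)\<bar>)"
        using y_orb by (intro expansion) (auto intro: less_imp_le)
      show "0 \<le> sqrt ((F a ^^ n) y / y)" using y u0 y_orb[of n] by simp
    qed simp
    also have "\<dots> = \<bar>\<Prod>i<n. DF a ((F a ^^ i) y)\<bar>"
      using y_orb by (intro abs_prod_DF[symmetric]) blast
    finally have "4/5 * ((8/5) ^ n * (1/32) ^ total_loss n) * (crit_value a - u)
        \<le> \<bar>\<Prod>i<n. DF a ((F a ^^ i) y)\<bar> * (crit_value a - u)"
      using u by (intro mult_right_mono) auto
    also have "\<dots> = \<bar>(F a ^^ n) (crit_value a) - (F a ^^ n) u\<bar>"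
      using u unfolding y(3) by (simp add: abs_mult)
    also have "\<dots> \<le> 1"
      using same[of u "(F a ^^ n) u" n] u orb_range[of n] unfolding orb_def by auto
    finally show ?thesis by (simp only: mult_ac)
  qed
  define l where "l = ln (8/5 :: real)"
  have l: "l > 0" "ln (32 :: real) > 0" by (simp_all add: l_def)
  obtain C where C: "\<And>n. total_loss n \<le> l / (2 * ln 32) * n + C"
    using total_loss_sublinear[of "l / (2 * ln 32)"] l by auto
  have "l / 2 * real k \<le> C * ln 32 - ln (4/5 * (crit_value a - u))" for k
  proof -
    define n where "n = stage_start k"
    have "ln ((8/5) ^ n * (1/32) ^ total_loss n * (4/5 * (crit_value a - u))) \<le> 0"
      using bound[of n] kneading_stage_start[of k] u by (subst ln_le_zero_iff) (auto simp: n_def)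
    moreover have "ln ((8/5) ^ n * (1/32) ^ total_loss n * (4/5 * (crit_value a - u)))
        = n * l + total_loss n * ln (1/32) + ln (4/5 * (crit_value a - u))"
    proof -
      have "ln ((8/5) ^ n * (1/32) ^ total_loss n * (4/5 * (crit_value a - u)))
          = ln ((8/5 :: real) ^ n) + ln ((1/32 :: real) ^ total_loss n) + ln (4/5 * (crit_value a - u))"
        using u by (subst ln_mult; simp)+
      then show ?thesis by (simp only: ln_realpow zero_less_divide_iff zero_less_numeral l_def simp_thms zero_less_one)
    qed
    moreover have "total_loss n * ln (1/32 :: real) = - (total_loss n * ln 32)"
      by (simp add: ln_div)
    moreover have "total_loss n * ln 32 \<le> n * l / 2 + C * ln (32 :: real)"
    proof -
      have "total_loss n * ln 32 \<le> (l / (2 * ln 32) * n + C) * ln (32 :: real)"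
        using C[of n] l by (intro mult_right_mono) auto
      also have "\<dots> = n * l / 2 + C * ln (32 :: real)" using l by (simp add: field_simps)
      finally show ?thesis .
    qed
    moreover have "l / 2 * k \<le> n * l / 2" using l stage_start_lower[of k] by (simp add: n_def)
    ultimately show ?thesis by argo
  qed
  moreover obtain k :: nat where "2 / l * (C * ln 32 - ln (4/5 * (crit_value a - u))) < k"
    using reals_Archimedean2 by blast
  then have "C * ln 32 - ln (4/5 * (crit_value a - u)) < l / 2 * k" using l by (simp add: field_simps)
  ultimately show False by (meson not_le)
qed

text \<open>
  The stage \<open>(stage_start j + 1)\<^sup>2\<close> is late enough for its copy to have length
  at least \<open>stage_start j\<close>. One step before this stage begins, the critical orbit is
  close to the critical point.
\<close>

definition return_time :: "nat \<Rightarrow> nat" where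
  "return_time j = stage_start ((stage_start j + 1)\<^sup>2) - 1"

lemma return_time:
  obtains k where "Suc (return_time j) = stage_start (Suc k)" "j < copy_len (Suc k)"
proof
  define k where "k = (stage_start j + 1)\<^sup>2 - 1"
  have k: "Suc k = (stage_start j + 1)\<^sup>2" by (simp add: k_def)
  show "Suc (return_time j) = stage_start (Suc k)"
    using stage_start_lower[of "Suc k"] unfolding return_time_def k by linarith
  have "j < stage_start j" using stage_start_lower[of j] by simp
  also have "stage_start j \<le> copy_len (Suc k)"
    using strict_mono_less_eq[OF strict_mono_stage_start] copy_index_ge[of j "Suc k"] unfolding copy_len_def k
    by simp
  finally show "j < copy_len (Suc k)" .
qed

lemma strict_mono_return_time: "strict_mono return_time"
proof (rule strict_monoI_Suc)
  fix j
  have "stage_start j + 1 < stage_start (Suc j) + 1" using strict_mono_less[OF strict_mono_stage_start, of j "Suc j"] by simp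
  then have "(stage_start j + 1)\<^sup>2 < (stage_start (Suc j) + 1)\<^sup>2" by (intro power_strict_mono) auto
  then have "stage_start ((stage_start j + 1)\<^sup>2) < stage_start ((stage_start (Suc j) + 1)\<^sup>2)"
    using strict_mono_less[OF strict_mono_stage_start] by blast
  moreover have "2 \<le> stage_start ((stage_start j + 1)\<^sup>2)" using stage_start_lower[of "(stage_start j + 1)\<^sup>2"] by linarith
  ultimately show "return_time j < return_time (Suc j)" unfolding return_time_def by linarith
qed

text \<open>
  By \<open>returns_close\<close> the orbit comes close to the critical value at the beginning of
  the stages with long copies; one step earlier it is in the left branch, hence close to the
  critical point.
\<close>

lemma orb_returns: "(\<lambda>j. orb (return_time j)) \<longlonglongrightarrow> c1 a"
proof (rule LIMSEQ_I)
  fix r :: real assume r: "0 < r"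
  define e where "e = min r (c1 a)"
  have e: "0 < e" "e \<le> r" "e \<le> c1 a" using r crit_bounds(3)[OF a] by (auto simp: e_def)
  have "F a (c1 a - e) < F a (c1 a)"
    using strict_mono_onD[OF F_strict_mono_left[OF a], of "c1 a - e" "c1 a"] e by auto
  then obtain j0 where j0: "\<And>k. j0 < copy_len k \<Longrightarrow> F a (c1 a - e) < orb (stage_start k)"
    using returns_close unfolding crit_value_def by blast
  show "\<exists>j0. \<forall>j\<ge>j0. norm (orb (return_time j) - c1 a) < r"
  proof (intro exI[of _ j0] allI impI)
    fix j assume "j0 \<le> j"
    obtain i where k: "Suc (return_time j) = stage_start (Suc i)" "j < copy_len (Suc i)" by (rule return_time)
    have "\<not> kneading (return_time j)"
    proof -
      have "stage_start i + copy_len i \<le> return_time j"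
        using copy_len_gap[of i] copy_len_ge_2[of i] k(1) by linarith
      then have "copy_len i \<le> return_time j - stage_start i" "stage_start i + (return_time j - stage_start i) = return_time j"
        by linarith+
      moreover have "return_time j < stage_start (Suc i)" using k(1) by linarith
      ultimately show ?thesis using kneading_run[of i "return_time j - stage_start i"] by metis
    qed
    then have left: "orb (return_time j) \<le> c1 a" by (rule orb_symbol)
    have "F a (c1 a - e) < F a (orb (return_time j))"
      using j0[of "Suc i"] k(2) \<open>j0 \<le> j\<close> unfolding k(1)[symmetric] orb_Suc by linarith
    then have "c1 a - e < orb (return_time j)"
      using F_left_le_iff[OF a, of "orb (return_time j)" "c1 a - e"] left e
        orb_range[of "return_time j"] by (auto simp flip: not_le)
    then show "norm (orb (return_time j) - c1 a) < r" using left e by auto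
  qed
qed

lemma recurrent_G: "recurrent (G a) ((c1 a)\<^sup>2)"
  unfolding recurrent_def omega_limit_def
proof (intro CollectI exI conjI)
  show "strict_mono return_time" by (rule strict_mono_return_time)
  have eq: "(G a ^^ Suc n) ((c1 a)\<^sup>2) = (orb n)\<^sup>2" for n
    unfolding funpow_Suc_right o_apply G_square G_funpow orb_def crit_value_def ..
  show "((\<lambda>n. (G a ^^ Suc n) ((c1 a)\<^sup>2)) \<circ> return_time) \<longlonglongrightarrow> (c1 a)\<^sup>2"
    unfolding eq comp_def by (intro tendsto_power orb_returns)
qed

lemma not_RCE_G: "\<not> RCE (G a)"
  using recurrent_G not_Collet_Eckmann_G Crit_G[OF a] unfolding RCE_def by auto

lemma RCE_F: "RCE (F a)"
proof -
  have "(F a ^^ Suc n) (c2 a) = 0" for n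
    by (induction n) (simp_all add: F_c2[OF a] F_simps)
  then have "\<not> recurrent (F a) (c2 a)"
    using crit_bounds(5)[OF a] unfolding recurrent_def omega_limit_def
    by (auto simp: comp_def LIMSEQ_const_iff)
  then show ?thesis
    using Collet_Eckmann_F Crit_F[OF a] unfolding RCE_def by auto
qed

end

section \<open>RCE is not a topological invariant\<close>

theorem theoremB:
  shows "\<exists>f g \<phi> \<psi>. real_analytic f \<and> S_multimodal f \<and> real_analytic g \<and> S_multimodal g \<and>
           homeomorphism I01 I01 \<phi> \<psi> \<and> (\<forall>x\<in>I01. \<phi> (f x) = g (\<phi> x)) \<and>
           RCE f \<and> \<not> RCE g"
proof -
  have "\<exists>d. (\<forall>i<d. kneading (n + i) = kneading i) \<and> \<not> kneading (n + d) \<and> kneading d" if "1 \<le> n" for n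
    using tails_fall_below[OF that] unfolding falls_below_def by blast
  then obtain a where a: "a \<in> params" "\<And>i. follows kneading a i"
    using exists_param_itinerary[of kneading, OF kneading_0 not_kneading_1] by blast
  have "homeomorphism I01 I01 (\<lambda>x. x\<^sup>2) sqrt"
    by (rule homeomorphismI) (auto intro!: continuous_intros simp: power_le_one)
  moreover have "\<forall>x\<in>I01. (F a x)\<^sup>2 = G a (x\<^sup>2)" by (simp add: G_square)
  moreover have "real_analytic (F a)" "real_analytic (G a)"
    unfolding F_poly G_poly by (rule real_analytic_poly)+
  ultimately show ?thesis
    using S_multimodal_F[OF a(1)] S_multimodal_G[OF a(1)] RCE_F[OF a] not_RCE_G[OF a]
    by (intro exI[of _ "F a"] exI[of _ "G a"] exI[of _ "\<lambda>x. x\<^sup>2"] exI[of _ sqrt]) auto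
qed

end
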